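(* The deep contraction rule is admissible for Herbrand proofs: for every one-hole context $\Gamma\{\,\}$ and every formula $A$ of first-order logic, if the sequent $\Gamma\{A\lor A\}$ has an Herbrand proof, then the sequent $\Gamma\{A\}$ has an Herbrand proof.
   Context: Setting. Pure first-order logic (no equality, no nonlogical axioms) over a signature of relation symbols and function symbols containing at least one constant symbol. Formulae are always in negation normal form: built from atoms and negated atoms with $\land,\lor,\forall,\exists$, the negation of a general formula being given by the De Morgan laws. Formulae are considered modulo renaming of bound variables ($\alpha$-equivalence). A formula is alpha-normal if, for each variable $x$, it contains at most one occurrence of a quantifier $\forall x$ or $\exists x$; every formula is $\alpha$-equivalent to an alpha-normal one. Bound variables are chosen distinct from free variables, so that no capture occurs in prenexing. A formula is in prenex normal form if it has the form $Q.M$ with $Q$ a sequence of quantifiers and $M$ quantifier-free; $M$ is its matrix. A (one-sided) sequent $\Gamma=A_1,\dots,A_n$ is a finite sequence of formulae, and $\bigvee\Gamma$ is the disjunction of its members. Contexts. A one-hole context $\Gamma\{\,\}$ is a sequent with precisely one positive occurrence of a special atom $\{\,\}$ (the hole), which may lie at any depth inside a formula of the sequent, including under quantifiers. $\Gamma\{A\}$ is the sequent obtained by replacing the hole by $A$ (variables of $A$ may become bound by quantifiers of $\Gamma\{\,\}$). Strong $\lor$-expansion. A strong $\lor$-expansion of a formula $A$ is any formula obtained from $A$ by finitely many (possibly zero) applications of the following operation: in the current strong $\lor$-expansion $A'$ of $A$, replace a subformula occurrence $B$ whose outermost connective is an existential quantifier by $B\lor B$. (Bound variables may then be renamed to make the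 result alpha-normal.) A strong $\lor$-expansion $\hat\Gamma$ of a sequent $\Gamma=A_1,\dots,A_n$ is a sequence $\hat A_1,\dots,\hat A_n$ of strong $\lor$-expansions of its members. Prenexification. A prenexification of an alpha-normal formula $A$ is a formula in prenex normal form derived from $A$ by successive applications of the operations $(qx.A)*B \rightsquigarrow qx.(A*B)$ and $A*(qx.B)\rightsquigarrow qx.(A*B)$, with $q\in\{\forall,\exists\}$ and $*\in\{\land,\lor\}$ (applied to subformulae). If $\bigvee\Gamma$ is alpha-normal, a prenexification of the sequent $\Gamma$ is a prenexification of $\bigvee\Gamma$. Witnessing substitution. Let $A$ be a valid alpha-normal formula in prenex normal form with $r\ge 0$ existential quantifiers, so that $A$ has the form $$(\forall x_1\cdots\forall x_{n_1})(\exists y_1)(\forall x_{n_1+1}\cdots\forall x_{n_2})(\exists y_2)\cdots(\exists y_r)(\forall x_{n_r+1}\cdots\forall x_{n_{r+1}})\,B(\bar x,\bar y)$$ with $B$ quantifier-free and $0\le n_1\le n_2\le\cdots\le n_{r+1}$. A witnessing substitution for $A$ is a sequence of terms $t_1,\dots,t_r$ such that (1) each $t_i$ may contain arbitrary free variables but, among bound variables, only variables from $x_1,\dots,x_{n_i}$; and (2) the formula $B(\bar x,t_1,\dots,t_r)$ is a (propositional) tautology. Herbrand proof of a sequent. An Herbrand proof of a sequent $\Gamma$ is a triple $(\hat\Gamma,\Gamma^*,\sigma)$ consisting of a strong $\lor$-expansion $\hat\Gamma$ of $\Gamma$, a prenexification $\Gamma^*$ of $\hat\Gamma$, and a witnessing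 substitution $\sigma$ for $\Gamma^*$. A rule is admissible for Herbrand proofs if, for each instance, whenever the premises have Herbrand proofs, so does the conclusion. *)

theory Defs
  imports Main
begin

section \<open>Formulae in negation normal form\<close>

datatype 'f tm = Var nat | Fun 'f "'f tm list"

datatype conn = And | Or

datatype quant = All | Ex

datatype ('f, 'p) fm =
    Pos 'p "'f tm list"
  | Neg 'p "'f tm list"
  | Conn conn "('f, 'p) fm" "('f, 'p) fm"
  | Quant quant nat "('f, 'p) fm"

text \<open>A signature is a type \<open>'f\<close> of function symbols and a type \<open>'p\<close> of relation symbols with
  arity functions \<open>fa\<close> and \<open>pa\<close>; constants are the function symbols of arity \<open>0\<close>.\<close>

primrec wf_tm :: "('f \<Rightarrow> nat) \<Rightarrow> 'f tm \<Rightarrow> bool" where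
  "wf_tm fa (Var x) \<longleftrightarrow> True"
| "wf_tm fa (Fun f ts) \<longleftrightarrow> length ts = fa f \<and> list_all (wf_tm fa) ts"

primrec wf_fm :: "('f \<Rightarrow> nat) \<Rightarrow> ('p \<Rightarrow> nat) \<Rightarrow> ('f, 'p) fm \<Rightarrow> bool" where
  "wf_fm fa pa (Pos p ts) \<longleftrightarrow> length ts = pa p \<and> list_all (wf_tm fa) ts"
| "wf_fm fa pa (Neg p ts) \<longleftrightarrow> length ts = pa p \<and> list_all (wf_tm fa) ts"
| "wf_fm fa pa (Conn c A B) \<longleftrightarrow> wf_fm fa pa A \<and> wf_fm fa pa B"
| "wf_fm fa pa (Quant q x A) \<longleftrightarrow> wf_fm fa pa A"

primrec tvars :: "'f tm \<Rightarrow> nat set" where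
  "tvars (Var x) = {x}"
| "tvars (Fun f ts) = \<Union> (set (map tvars ts))"

primrec fvars :: "('f, 'p) fm \<Rightarrow> nat set" where
  "fvars (Pos p ts) = (\<Union>t\<in>set ts. tvars t)"
| "fvars (Neg p ts) = (\<Union>t\<in>set ts. tvars t)"
| "fvars (Conn c A B) = fvars A \<union> fvars B"
| "fvars (Quant q x A) = fvars A - {x}"

text \<open>The quantified variables, one entry per quantifier occurrence.\<close>

primrec bvars :: "('f, 'p) fm \<Rightarrow> nat list" where
  "bvars (Pos p ts) = []"
| "bvars (Neg p ts) = []"
| "bvars (Conn c A B) = bvars A @ bvars B"
| "bvars (Quant q x A) = x # bvars A"

definition alpha_normal :: "('f, 'p) fm \<Rightarrow> bool" where
  "alpha_normal A \<longleftrightarrow> distinct (bvars A)"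

primrec subst_tm :: "(nat \<Rightarrow> 'f tm) \<Rightarrow> 'f tm \<Rightarrow> 'f tm" where
  "subst_tm s (Var x) = s x"
| "subst_tm s (Fun f ts) = Fun f (map (subst_tm s) ts)"

text \<open>Simultaneous replacement of free occurrences. It does not rename bound variables; it is only
  applied to quantifier-free formulae, or with fresh variables as replacements.\<close>

primrec subst :: "(nat \<Rightarrow> 'f tm) \<Rightarrow> ('f, 'p) fm \<Rightarrow> ('f, 'p) fm" where
  "subst s (Pos p ts) = Pos p (map (subst_tm s) ts)"
| "subst s (Neg p ts) = Neg p (map (subst_tm s) ts)"
| "subst s (Conn c A B) = Conn c (subst s A) (subst s B)"
| "subst s (Quant q x A) = Quant q x (subst (s(x := Var x)) A)"

inductive alpha_equiv :: "('f, 'p) fm \<Rightarrow> ('f, 'p) fm \<Rightarrow> bool" where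
  rename: "y \<notin> fvars A \<union> set (bvars A) \<Longrightarrow>
    alpha_equiv (Quant q x A) (Quant q y (subst (Var(x := Var y)) A))"
| conn: "alpha_equiv A A' \<Longrightarrow> alpha_equiv B B' \<Longrightarrow> alpha_equiv (Conn c A B) (Conn c A' B')"
| quant: "alpha_equiv A A' \<Longrightarrow> alpha_equiv (Quant q x A) (Quant q x A')"
| refl: "alpha_equiv A A"
| sym: "alpha_equiv A B \<Longrightarrow> alpha_equiv B A"
| trans: "alpha_equiv A B \<Longrightarrow> alpha_equiv B C \<Longrightarrow> alpha_equiv A C"


section \<open>Sequents and contexts\<close>

text \<open>Sequents are nonempty lists; \<open>Disj []\<close> is unspecified, as there is no propositional constant.\<close>

fun Disj :: "('f, 'p) fm list \<Rightarrow> ('f, 'p) fm" where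
  "Disj [A] = A"
| "Disj (A # B # \<Gamma>) = Conn Or A (Disj (B # \<Gamma>))"

datatype ('f, 'p) fctx =
    Hole
  | ConnL conn "('f, 'p) fctx" "('f, 'p) fm"
  | ConnR conn "('f, 'p) fm" "('f, 'p) fctx"
  | QuantC quant nat "('f, 'p) fctx"

text \<open>Filling the hole is textual: free variables of \<open>A\<close> may be captured.\<close>

primrec fill_fctx :: "('f, 'p) fctx \<Rightarrow> ('f, 'p) fm \<Rightarrow> ('f, 'p) fm" where
  "fill_fctx Hole A = A"
| "fill_fctx (ConnL c K B) A = Conn c (fill_fctx K A) B"
| "fill_fctx (ConnR c B K) A = Conn c B (fill_fctx K A)"
| "fill_fctx (QuantC q x K) A = Quant q x (fill_fctx K A)"

primrec wf_fctx :: "('f \<Rightarrow> nat) \<Rightarrow> ('p \<Rightarrow> nat) \<Rightarrow> ('f, 'p) fctx \<Rightarrow> bool" where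
  "wf_fctx fa pa Hole \<longleftrightarrow> True"
| "wf_fctx fa pa (ConnL c K B) \<longleftrightarrow> wf_fctx fa pa K \<and> wf_fm fa pa B"
| "wf_fctx fa pa (ConnR c B K) \<longleftrightarrow> wf_fm fa pa B \<and> wf_fctx fa pa K"
| "wf_fctx fa pa (QuantC q x K) \<longleftrightarrow> wf_fctx fa pa K"

text \<open>\<open>SeqCtx \<Delta> K \<Theta>\<close> is the sequent \<open>\<Delta>, K, \<Theta>\<close> whose hole lies in \<open>K\<close>.\<close>

datatype ('f, 'p) sctx = SeqCtx "('f, 'p) fm list" "('f, 'p) fctx" "('f, 'p) fm list"

primrec fill :: "('f, 'p) sctx \<Rightarrow> ('f, 'p) fm \<Rightarrow> ('f, 'p) fm list" where
  "fill (SeqCtx \<Delta> K \<Theta>) A = \<Delta> @ [fill_fctx K A] @ \<Theta>"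

primrec wf_sctx :: "('f \<Rightarrow> nat) \<Rightarrow> ('p \<Rightarrow> nat) \<Rightarrow> ('f, 'p) sctx \<Rightarrow> bool" where
  "wf_sctx fa pa (SeqCtx \<Delta> K \<Theta>) \<longleftrightarrow>
    list_all (wf_fm fa pa) \<Delta> \<and> wf_fctx fa pa K \<and> list_all (wf_fm fa pa) \<Theta>"


section \<open>Herbrand proofs\<close>

inductive expand_step :: "('f, 'p) fm \<Rightarrow> ('f, 'p) fm \<Rightarrow> bool" where
  dup: "expand_step (Quant Ex x B) (Conn Or (Quant Ex x B) (Quant Ex x B))"
| connL: "expand_step A A' \<Longrightarrow> expand_step (Conn c A B) (Conn c A' B)"
| connR: "expand_step B B' \<Longrightarrow> expand_step (Conn c A B) (Conn c A B')"
| quant: "expand_step A A' \<Longrightarrow> expand_step (Quant q x A) (Quant q x A')"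

definition strong_or_expansion :: "('f, 'p) fm \<Rightarrow> ('f, 'p) fm \<Rightarrow> bool" where
  "strong_or_expansion A A' \<longleftrightarrow> (\<exists>C. expand_step\<^sup>*\<^sup>* A C \<and> alpha_equiv C A')"

definition strong_or_expansion_seq :: "('f, 'p) fm list \<Rightarrow> ('f, 'p) fm list \<Rightarrow> bool" where
  "strong_or_expansion_seq \<Gamma> \<Gamma>' \<longleftrightarrow> list_all2 strong_or_expansion \<Gamma> \<Gamma>'"

fun prefix :: "('f, 'p) fm \<Rightarrow> (quant \<times> nat) list" where
  "prefix (Quant q x A) = (q, x) # prefix A"
| "prefix A = []"

fun matrix :: "('f, 'p) fm \<Rightarrow> ('f, 'p) fm" where
  "matrix (Quant q x A) = matrix A"
| "matrix A = A"

primrec quantifier_free :: "('f, 'p) fm \<Rightarrow> bool" where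
  "quantifier_free (Pos p ts) \<longleftrightarrow> True"
| "quantifier_free (Neg p ts) \<longleftrightarrow> True"
| "quantifier_free (Conn c A B) \<longleftrightarrow> quantifier_free A \<and> quantifier_free B"
| "quantifier_free (Quant q x A) \<longleftrightarrow> False"

definition prenex :: "('f, 'p) fm \<Rightarrow> bool" where
  "prenex A \<longleftrightarrow> quantifier_free (matrix A)"

inductive prenex_step :: "('f, 'p) fm \<Rightarrow> ('f, 'p) fm \<Rightarrow> bool" where
  pullL: "prenex_step (Conn c (Quant q x A) B) (Quant q x (Conn c A B))"
| pullR: "prenex_step (Conn c A (Quant q x B)) (Quant q x (Conn c A B))"
| connL: "prenex_step A A' \<Longrightarrow> prenex_step (Conn c A B) (Conn c A' B)"
| connR: "prenex_step B B' \<Longrightarrow> prenex_step (Conn c A B) (Conn c A B')"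
| quant: "prenex_step A A' \<Longrightarrow> prenex_step (Quant q x A) (Quant q x A')"

text \<open>Alpha-normality and the separation of free from bound variables are invariant under
  \<open>prenex_step\<close>, so no step starting from \<open>A\<close> captures a variable.\<close>

definition prenexification :: "('f, 'p) fm \<Rightarrow> ('f, 'p) fm \<Rightarrow> bool" where
  "prenexification A P \<longleftrightarrow>
    alpha_normal A \<and> set (bvars A) \<inter> fvars A = {} \<and> prenex_step\<^sup>*\<^sup>* A P \<and> prenex P"

primrec prop_eval :: "('p \<Rightarrow> 'f tm list \<Rightarrow> bool) \<Rightarrow> ('f, 'p) fm \<Rightarrow> bool" where
  "prop_eval v (Pos p ts) \<longleftrightarrow> v p ts"
| "prop_eval v (Neg p ts) \<longleftrightarrow> \<not> v p ts"
| "prop_eval v (Conn c A B) \<longleftrightarrow>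
    (case c of And \<Rightarrow> prop_eval v A \<and> prop_eval v B | Or \<Rightarrow> prop_eval v A \<or> prop_eval v B)"
| "prop_eval v (Quant q x A) \<longleftrightarrow> undefined"

definition tautology :: "('f, 'p) fm \<Rightarrow> bool" where
  "tautology A \<longleftrightarrow> quantifier_free A \<and> (\<forall>v. prop_eval v A)"

definition quantified :: "quant \<Rightarrow> (quant \<times> nat) list \<Rightarrow> nat list" where
  "quantified q Q = map snd (filter (\<lambda>z. fst z = q) Q)"

definition witness_subst :: "(quant \<times> nat) list \<Rightarrow> 'f tm list \<Rightarrow> nat \<Rightarrow> 'f tm" where
  "witness_subst Q ts x =
    (case map_of (zip (quantified Ex Q) ts) x of Some t \<Rightarrow> t | None \<Rightarrow> Var x)"

text \<open>In the last-but-one clause, \<open>ts ! length (quantified Ex Q1)\<close> is the term for the quantifier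
  \<open>(Ex, y)\<close>. Validity of \<open>P\<close> is not a separate clause because it follows; see
  \<open>witnessing_substitution_valid\<close> below.\<close>

definition witnessing_substitution ::
  "('f \<Rightarrow> nat) \<Rightarrow> ('f, 'p) fm \<Rightarrow> 'f tm list \<Rightarrow> bool" where
  "witnessing_substitution fa P ts \<longleftrightarrow>
    alpha_normal P \<and> prenex P \<and>
    length ts = length (quantified Ex (prefix P)) \<and>
    list_all (wf_tm fa) ts \<and>
    (\<forall>Q1 y Q2. prefix P = Q1 @ (Ex, y) # Q2 \<longrightarrow>
      tvars (ts ! length (quantified Ex Q1)) \<inter> set (bvars P) \<subseteq> set (quantified All Q1)) \<and>
    tautology (subst (witness_subst (prefix P) ts) (matrix P))"

definition herbrand_proof ::
  "('f \<Rightarrow> nat) \<Rightarrow> ('f, 'p) fm list \<Rightarrow>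
    ('f, 'p) fm list \<times> ('f, 'p) fm \<times> 'f tm list \<Rightarrow> bool" where
  "herbrand_proof fa \<Gamma> = (\<lambda>(\<Gamma>', P, ts).
    strong_or_expansion_seq \<Gamma> \<Gamma>' \<and>
    prenexification (Disj \<Gamma>') P \<and>
    witnessing_substitution fa P ts)"

definition has_herbrand_proof :: "('f \<Rightarrow> nat) \<Rightarrow> ('f, 'p) fm list \<Rightarrow> bool" where
  "has_herbrand_proof fa \<Gamma> \<longleftrightarrow> (\<exists>\<pi>. herbrand_proof fa \<Gamma> \<pi>)"


section \<open>Formulae with a witnessing substitution are valid\<close>

primrec eval_tm :: "('f \<Rightarrow> 'd list \<Rightarrow> 'd) \<Rightarrow> (nat \<Rightarrow> 'd) \<Rightarrow> 'f tm \<Rightarrow> 'd" where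
  "eval_tm F e (Var x) = e x"
| "eval_tm F e (Fun f ts) = F f (map (eval_tm F e) ts)"

primrec sat :: "('f \<Rightarrow> 'd list \<Rightarrow> 'd) \<Rightarrow> ('p \<Rightarrow> 'd list \<Rightarrow> bool) \<Rightarrow> (nat \<Rightarrow> 'd) \<Rightarrow> ('f, 'p) fm \<Rightarrow> bool"
  where
  "sat F R e (Pos p ts) \<longleftrightarrow> R p (map (eval_tm F e) ts)"
| "sat F R e (Neg p ts) \<longleftrightarrow> \<not> R p (map (eval_tm F e) ts)"
| "sat F R e (Conn c A B) \<longleftrightarrow>
    (case c of And \<Rightarrow> sat F R e A \<and> sat F R e B | Or \<Rightarrow> sat F R e A \<or> sat F R e B)"
| "sat F R e (Quant q x A) \<longleftrightarrow>
    (case q of All \<Rightarrow> \<forall>d. sat F R (e(x := d)) A | Ex \<Rightarrow> \<exists>d. sat F R (e(x := d)) A)"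

lemma eval_subst_tm: "eval_tm F e (subst_tm s t) = eval_tm F (\<lambda>x. eval_tm F e (s x)) t"
  by (induction t) (auto intro: arg_cong)

lemma eval_tm_upd: "x \<notin> tvars t \<Longrightarrow> eval_tm F (e(x := d)) t = eval_tm F e t"
  by (induction t) (auto intro!: arg_cong[where f = "F _"])

lemma sat_subst:
  "quantifier_free M \<Longrightarrow> sat F R e (subst s M) = sat F R (\<lambda>x. eval_tm F e (s x)) M"
  by (induction M) (auto simp: eval_subst_tm o_def split: conn.split)

lemma sat_prop_eval:
  "quantifier_free M \<Longrightarrow> sat F R e M = prop_eval (\<lambda>p ts. R p (map (eval_tm F e) ts)) M"
  by (induction M) (auto split: conn.split)

lemma bvars_prenex: "prenex P \<Longrightarrow> bvars P = map snd (prefix P)"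
proof -
  have "quantifier_free A \<Longrightarrow> bvars A = []" for A :: "('f, 'p) fm"
    by (induction A) auto
  then show "prenex P \<Longrightarrow> bvars P = map snd (prefix P)" for P :: "('f, 'p) fm"
    by (induction P) (auto simp: prenex_def)
qed

lemma witnessing_substitution_valid:
  assumes "witnessing_substitution fa P ts"
  shows "sat F R e P"
proof -
  define w :: "nat \<Rightarrow> 'a tm" where "w = witness_subst (prefix P) ts"
  note ws = assms[unfolded witnessing_substitution_def, folded w_def]
  have bv: "bvars P = map snd (prefix P)"
    using ws by (intro bvars_prenex) blast
  have dist: "distinct (map snd (prefix P))"
    using ws unfolding alpha_normal_def bv by blast
  have qf: "quantifier_free (matrix P)"
    using ws unfolding prenex_def by blast
  have len: "length ts = length (quantified Ex (prefix P))"
    using ws by blast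
  have scope: "tvars (ts ! length (quantified Ex Q1)) \<inter> set (bvars P) \<subseteq> set (quantified All Q1)"
    if "prefix P = Q1 @ (Ex, y) # Q2" for Q1 y Q2
    using ws that by blast
  have taut: "tautology (subst w (matrix P))"
    using ws by blast
  have sub: "set (quantified q Q) \<subseteq> snd ` set Q" for q Q
    by (auto simp: quantified_def)
  have snoc: "quantified q (Q @ [(q', x)]) = quantified q Q @ (if q' = q then [x] else [])" for q Q q' x
    by (simp add: quantified_def)
  have w_None: "w x = Var x" if "x \<notin> set (quantified Ex (prefix P))" for x
  proof -
    have "map_of (zip (quantified Ex (prefix P)) ts) x = None"
      using that len by (simp add: map_of_zip_is_None)
    then show ?thesis by (simp add: w_def witness_subst_def)
  qed
  have w_scope: "tvars (w y) \<inter> set (bvars P) \<subseteq> set (quantified All Q1)"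
    if Q: "prefix P = Q1 @ (Ex, y) # Q2" for Q1 y Q2
  proof -
    let ?ys = "quantified Ex (prefix P)" and ?n = "length (quantified Ex Q1)"
    have ys: "?ys = quantified Ex Q1 @ y # quantified Ex Q2"
      using Q by (simp add: quantified_def)
    have "distinct ?ys"
      using dist by (simp add: quantified_def distinct_map_filter)
    then have "map_of (zip ?ys ts) (?ys ! ?n) = Some (ts ! ?n)"
      using len ys by (intro map_of_zip_nth) auto
    then have "w y = ts ! ?n"
      by (simp add: w_def witness_subst_def ys)
    then show ?thesis using scope[OF Q] by simp
  qed
  have upd: "x \<noteq> y \<and> x \<notin> tvars (w y)"
    if Q: "prefix P = Q1 @ (q, x) # Q2" and y: "y \<in> set (quantified Ex Q1)" for Q1 Q2 q x y
  proof -
    have "(Ex, y) \<in> set Q1" using y by (auto simp: quantified_def)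
    then obtain Q3 Q4 where Q1: "Q1 = Q3 @ (Ex, y) # Q4" by (meson split_list)
    have "x \<notin> snd ` set Q1" "x \<in> set (bvars P)" using dist Q bv by auto
    then show ?thesis
      using w_scope[of Q3 y "Q4 @ (q, x) # Q2"] Q Q1 sub[of All Q3] by fastforce
  qed
  have self: "x \<notin> tvars (w x)" if Q: "prefix P = Q1 @ (Ex, x) # Q2" for Q1 Q2 x
  proof -
    have "x \<notin> snd ` set Q1" "x \<in> set (bvars P)" using dist Q bv by auto
    then show ?thesis using w_scope[OF Q] sub[of All Q1] by blast
  qed
  have base: "sat F R e (matrix P)"
    if "\<forall>y\<in>set (quantified Ex (prefix P)). e y = eval_tm F e (w y)" for e
  proof -
    have "eval_tm F e (w x) = e x" for x
      by (cases "x \<in> set (quantified Ex (prefix P))") (use that w_None in auto)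
    then have "(\<lambda>x. eval_tm F e (w x)) = e" by blast
    moreover have "sat F R e (subst w (matrix P))"
      using taut by (simp add: tautology_def sat_prop_eval)
    ultimately show ?thesis using sat_subst[OF qf, of F R e w] by simp
  qed
  have "sat F R e A"
    if "prefix P = Q1 @ prefix A" "matrix A = matrix P"
      "\<forall>y\<in>set (quantified Ex Q1). e y = eval_tm F e (w y)" for Q1 A e
    using that
  proof (induction A arbitrary: Q1 e)
    case (Quant q x A)
    have Q: "prefix P = Q1 @ (q, x) # prefix A" using Quant.prems by simp
    have inv: "\<forall>y\<in>set (quantified Ex Q1). (e(x := d)) y = eval_tm F (e(x := d)) (w y)" for d
      using Quant.prems(3) upd[OF Q] by (auto simp: eval_tm_upd)
    show ?case
    proof (cases q)
      case All
      have "sat F R (e(x := d)) A" for d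
        using Quant.IH[of "Q1 @ [(q, x)]" "e(x := d)"] Quant.prems inv All
        by (simp add: snoc del: fun_upd_apply)
      then show ?thesis using All by simp
    next
      case Ex
      let ?e = "e(x := eval_tm F e (w x))"
      have "?e x = eval_tm F ?e (w x)"
        using self Q Ex by (simp add: eval_tm_upd)
      then have "sat F R ?e A"
        using Quant.IH[of "Q1 @ [(q, x)]" ?e] Quant.prems inv Ex
        by (simp add: snoc ball_Un del: fun_upd_apply)
      then show ?thesis using Ex by auto
    qed
  qed (use base in auto)
  from this[of "[]" P e] show ?thesis by (simp add: quantified_def)
qed

end

theory Submission
  imports Defs "HOL-Library.Multiset"
begin

text \<open>
  Contraction is performed on the Herbrand proof, not derived as a rule. In a strong expansion of
  \<open>\<Gamma>{A \<or> A}\<close>, each copy of the hole holds a disjunction \<open>E1 \<or> E2\<close> of two expansions of \<open>A\<close>. It suffices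
  to replace each of these disjunctions by one expansion of \<open>A\<close> while keeping the order of the
  quantifiers and the witnesses under control (\<open>merge_variants\<close>). Following the structure of \<open>A\<close>:

  \<^item> If \<open>A\<close> is a literal, then \<open>E1\<close> and \<open>E2\<close> are the same literal, and idempotence applies.

  \<^item> If \<open>A\<close> is a conjunction or a disjunction, then the medial rearrangement
    \<open>(A1 * B1) \<or> (A2 * B2)\<close> to \<open>(A1 \<or> A2) * (B1 \<or> B2)\<close> weakens the matrix and leaves the nesting of the
    quantifiers alone, so that prefix and witnesses can stay (\<open>refines_medial\<close>). The merging goes
    on in both components.

  \<^item> If \<open>A\<close> is existential, then \<open>E1 \<or> E2\<close> already is a strong expansion of \<open>A\<close>.

  \<^item> If \<open>A\<close> is universal, then \<open>E1\<close> and \<open>E2\<close> begin with \<open>\<forall>y\<close> and \<open>\<forall>z\<close>. Of these, the quantifier that comes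
    second in the prefix is deleted and its variable is replaced by the other one everywhere, also
    in the witnesses. A term that may mention the second variable may also mention the first, so
    the witnesses remain admissible, and a substitution instance of a tautology is a tautology
    (\<open>herbrand_via_merge_earlier\<close>). The merging goes on below the quantifier.

  Two changes of representation make these steps precise. Strong expansion, which is rewriting
  followed by renaming, becomes a relation \<open>variant\<close> defined by recursion on the original formula
  (\<open>strong_or_expansion_iff_variant\<close>). Prenexification is replaced by its result: a prefix is any
  order of the quantifiers obtained by shuffling the prefixes of the components, and the matrix is
  the formula without its quantifiers (\<open>prenex_steps_orders\<close>, \<open>prenex_steps_quantify\<close>).
\<close>

section \<open>Renaming of variables\<close>
definition ren_tm :: "(nat \<Rightarrow> nat) \<Rightarrow> 'f tm \<Rightarrow> 'f tm" where
  "ren_tm \<sigma> = subst_tm (\<lambda>v. Var (\<sigma> v))"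

definition ren :: "(nat \<Rightarrow> nat) \<Rightarrow> ('f, 'p) fm \<Rightarrow> ('f, 'p) fm" where
  "ren \<sigma> = subst (\<lambda>v. Var (\<sigma> v))"

lemma ren_simps [simp]:
  "ren \<sigma> (Pos p ts) = Pos p (map (ren_tm \<sigma>) ts)"
  "ren \<sigma> (Neg p ts) = Neg p (map (ren_tm \<sigma>) ts)"
  "ren \<sigma> (Conn c A B) = Conn c (ren \<sigma> A) (ren \<sigma> B)"
  "ren \<sigma> (Quant q x A) = Quant q x (ren (\<sigma>(x := x)) A)"
  by (auto simp: ren_def ren_tm_def fun_upd_def intro!: arg_cong[where f = "\<lambda>s. subst s A"])

lemma ren_id_upd: "subst (Var(x := Var y)) A = ren ((\<lambda>v. v)(x := y)) A"
proof -
  have "(Var(x := Var y) :: nat \<Rightarrow> 'a tm) = (\<lambda>v. Var (((\<lambda>v. v)(x := y)) v))"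
    by auto
  then show ?thesis
    by (simp add: ren_def del: fun_upd_apply)
qed

lemma ren_tm_cong: "(\<And>v. v \<in> tvars t \<Longrightarrow> \<sigma> v = \<tau> v) \<Longrightarrow> ren_tm \<sigma> t = ren_tm \<tau> t"
  by (induction t) (auto simp: ren_tm_def)

lemma ren_tm_comp: "ren_tm \<sigma> (ren_tm \<tau> t) = ren_tm (\<lambda>v. \<sigma> (\<tau> v)) t"
  by (induction t) (auto simp: ren_tm_def)

lemma ren_tm_id [simp]: "ren_tm (\<lambda>v. v) t = t"
  by (induction t) (auto simp: ren_tm_def map_idI)

lemma tvars_ren_tm [simp]: "tvars (ren_tm \<sigma> t) = \<sigma> ` tvars t"
  by (induction t) (auto simp: ren_tm_def)

lemma wf_ren_tm [simp]: "wf_tm fa (ren_tm \<sigma> t) = wf_tm fa t"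
  by (induction t) (auto simp: ren_tm_def list_all_iff)

lemma bvars_ren [simp]: "bvars (ren \<sigma> A) = bvars A"
  by (induction A arbitrary: \<sigma>) auto

text \<open>A variable fixed by \<open>\<sigma>\<close> is exempt: a free \<open>v\<close> of \<open>A\<close> may also occur in \<open>bvars A\<close>, and renaming
  it to itself changes nothing. This exemption is what lets the condition pass under a quantifier,
  where \<open>\<sigma>\<close> is updated to fix the bound variable.\<close>
definition avoids_capture :: "(nat \<Rightarrow> nat) \<Rightarrow> ('f, 'p) fm \<Rightarrow> bool" where
  "avoids_capture \<sigma> A \<longleftrightarrow> (\<forall>v\<in>fvars A. \<sigma> v = v \<or> \<sigma> v \<notin> set (bvars A))"

lemma avoids_capture_Conn:
  "avoids_capture \<sigma> (Conn c A B) \<Longrightarrow> avoids_capture \<sigma> A \<and> avoids_capture \<sigma> B"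
  by (auto simp: avoids_capture_def)

lemma avoids_capture_QuantD:
  "avoids_capture \<sigma> (Quant q x A) \<Longrightarrow> avoids_capture (\<sigma>(x := x)) A"
  by (auto simp: avoids_capture_def)

lemma avoids_capture_Quant_neq:
  "avoids_capture \<sigma> (Quant q x A) \<Longrightarrow> v \<in> fvars A \<Longrightarrow> v \<noteq> x \<Longrightarrow> \<sigma> v \<noteq> x"
  unfolding avoids_capture_def by (metis DiffI bvars.simps(4) fvars.simps(4) list.set_intros(1) singletonD)

lemma ren_cong: "(\<And>v. v \<in> fvars A \<Longrightarrow> \<sigma> v = \<tau> v) \<Longrightarrow> ren \<sigma> A = ren \<tau> A"
proof (induction A arbitrary: \<sigma> \<tau>)
  case (Quant q x A)
  then have "ren (\<sigma>(x := x)) A = ren (\<tau>(x := x)) A"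
    by (intro Quant.IH) auto
  then show ?case by simp
next
  case (Conn c A B)
  have "ren \<sigma> A = ren \<tau> A" "ren \<sigma> B = ren \<tau> B"
    using Conn.prems by (auto intro: Conn.IH)
  then show ?case by simp
qed (auto intro!: ren_tm_cong)

lemma ren_id [simp]: "ren (\<lambda>v. v) A = A"
proof (induction A)
  case (Quant q x A)
  have "(\<lambda>v. v)(x := x) = (\<lambda>v. v)" by auto
  then show ?case unfolding ren_simps using Quant by (simp only:)
qed (simp_all add: map_idI)

lemma fvars_ren: "avoids_capture \<sigma> A \<Longrightarrow> fvars (ren \<sigma> A) = \<sigma> ` fvars A"
proof (induction A arbitrary: \<sigma>)
  case (Quant q x A)
  have "fvars (ren (\<sigma>(x := x)) A) = (\<sigma>(x := x)) ` fvars A"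
    using Quant by (blast dest: avoids_capture_QuantD)
  then show ?case
    using avoids_capture_Quant_neq[OF Quant.prems] by auto
next
  case (Conn c A B)
  then show ?case by (auto simp: image_Un dest: avoids_capture_Conn)
qed auto

lemma fvars_ren_subset: "fvars (ren \<sigma> A) \<subseteq> \<sigma> ` fvars A"
proof (induction A arbitrary: \<sigma>)
  case (Quant q x A)
  have "fvars (ren (\<sigma>(x := x)) A) \<subseteq> (\<sigma>(x := x)) ` fvars A"
    by (rule Quant)
  then show ?case
    by (auto split: if_splits)
next
  case (Conn c A B)
  then show ?case unfolding ren_simps fvars.simps image_Un by (rule Un_mono)
qed auto

lemma ren_comp: "avoids_capture \<tau> A \<Longrightarrow> ren \<sigma> (ren \<tau> A) = ren (\<lambda>v. \<sigma> (\<tau> v)) A"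
proof (induction A arbitrary: \<sigma> \<tau>)
  case (Quant q x A)
  have "ren (\<sigma>(x := x)) (ren (\<tau>(x := x)) A) = ren (\<lambda>v. (\<sigma>(x := x)) ((\<tau>(x := x)) v)) A"
    using Quant by (blast dest: avoids_capture_QuantD)
  also have "\<dots> = ren ((\<lambda>v. \<sigma> (\<tau> v))(x := x)) A"
    using avoids_capture_Quant_neq[OF Quant.prems] by (intro ren_cong) auto
  finally show ?case unfolding ren_simps by simp
qed (auto simp: ren_tm_comp dest: avoids_capture_Conn)

section \<open>Strong expansions up to renaming\<close>
text \<open>The trees of disjunctions with leaves in \<open>P\<close> that repeated duplication produces; if \<open>b\<close> is false,
  only single leaves.\<close>
inductive copies :: "bool \<Rightarrow> (('f, 'p) fm \<Rightarrow> bool) \<Rightarrow> ('f, 'p) fm \<Rightarrow> bool" for b P where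
  single: "P E \<Longrightarrow> copies b P E"
| dup: "b \<Longrightarrow> copies b P E1 \<Longrightarrow> copies b P E2 \<Longrightarrow> copies b P (Conn Or E1 E2)"

lemma copies_mono: "P \<le> Q \<Longrightarrow> copies b P \<le> copies b Q"
proof (rule predicate1I)
  fix E assume "copies b P E" "P \<le> Q"
  then show "copies b Q E"
    by induction (auto intro: copies.intros)
qed

text \<open>\<open>variant d \<rho> A E\<close> compares \<open>A\<close> and \<open>E\<close> by a simultaneous descent, where \<open>\<rho>\<close> sends each variable of \<open>A\<close>
  to the one that stands for it in \<open>E\<close>. For \<open>d = True\<close> and the identity, this is strong
  \<open>\<or>\<close>-expansion up to renaming; for \<open>d = False\<close> it is plain \<open>\<alpha>\<close>-equivalence. The advantage over rewriting
  followed by \<open>\<alpha>\<close>-conversion is that every copy of a subformula gets its own names at once, so that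
  two expansions of one formula can be compared and merged by induction on the formula. The
  condition \<open>y \<notin> \<rho> ` (fvars A - {x})\<close> says that the new bound variable captures nothing.\<close>
primrec variant :: "bool \<Rightarrow> (nat \<Rightarrow> nat) \<Rightarrow> ('f, 'p) fm \<Rightarrow> ('f, 'p) fm \<Rightarrow> bool" where
  "variant d \<rho> (Pos p ts) = (\<lambda>E. E = Pos p (map (ren_tm \<rho>) ts))"
| "variant d \<rho> (Neg p ts) = (\<lambda>E. E = Neg p (map (ren_tm \<rho>) ts))"
| "variant d \<rho> (Conn c A B) =
    (\<lambda>E. \<exists>E1 E2. E = Conn c E1 E2 \<and> variant d \<rho> A E1 \<and> variant d \<rho> B E2)"
| "variant d \<rho> (Quant q x A) = copies (d \<and> q = Ex)
    (\<lambda>E. \<exists>y D. E = Quant q y D \<and> y \<notin> \<rho> ` (fvars A - {x}) \<and> variant d (\<rho>(x := y)) A D)"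

lemma variant_cong: "(\<And>v. v \<in> fvars A \<Longrightarrow> \<sigma> v = \<tau> v) \<Longrightarrow> variant d \<sigma> A = variant d \<tau> A"
proof (induction A arbitrary: \<sigma> \<tau>)
  case (Pos p ts)
  then have "map (ren_tm \<sigma>) ts = map (ren_tm \<tau>) ts" by (auto intro!: ren_tm_cong)
  then show ?case by (simp only: variant.simps)
next
  case (Neg p ts)
  then have "map (ren_tm \<sigma>) ts = map (ren_tm \<tau>) ts" by (auto intro!: ren_tm_cong)
  then show ?case by (simp only: variant.simps)
next
  case (Conn c A B)
  have "variant d \<sigma> A = variant d \<tau> A" "variant d \<sigma> B = variant d \<tau> B"
    using Conn.prems by (auto intro: Conn.IH)
  then show ?case by simp
next
  case (Quant q x A)
  have "variant d (\<sigma>(x := y)) A = variant d (\<tau>(x := y)) A" for y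
    using Quant.prems by (intro Quant.IH) auto
  moreover have "\<sigma> ` (fvars A - {x}) = \<tau> ` (fvars A - {x})"
    using Quant.prems by (intro image_cong) auto
  ultimately show ?case by simp
qed

lemma variant_refl: "variant d (\<lambda>v. v) A A"
proof (induction A)
  case (Quant q x A)
  have "(\<lambda>v. v)(x := x) = (\<lambda>v. v)" by auto
  then have "variant d ((\<lambda>v. v)(x := x)) A A" using Quant by (simp only:)
  then show ?case unfolding variant.simps by (intro copies.single) auto
qed (auto simp: map_idI)

lemma variant_ren_source:
  "avoids_capture \<sigma> A \<Longrightarrow> variant d \<rho> (ren \<sigma> A) = variant d (\<lambda>v. \<rho> (\<sigma> v)) A"
proof (induction A arbitrary: \<rho> \<sigma>)
  case (Quant q x A)
  have ac: "avoids_capture (\<sigma>(x := x)) A"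
    using Quant.prems by (rule avoids_capture_QuantD)
  note neq = avoids_capture_Quant_neq[OF Quant.prems]
  have "variant d (\<rho>(x := y)) (ren (\<sigma>(x := x)) A) = variant d ((\<lambda>v. \<rho> (\<sigma> v))(x := y)) A" for y
  proof -
    have "variant d (\<rho>(x := y)) (ren (\<sigma>(x := x)) A) = variant d (\<lambda>v. (\<rho>(x := y)) ((\<sigma>(x := x)) v)) A"
      by (rule Quant.IH[OF ac])
    also have "\<dots> = variant d ((\<lambda>v. \<rho> (\<sigma> v))(x := y)) A"
      using neq by (intro variant_cong) auto
    finally show ?thesis .
  qed
  moreover have "\<rho> ` (fvars (ren (\<sigma>(x := x)) A) - {x}) = (\<lambda>v. \<rho> (\<sigma> v)) ` (fvars A - {x})"
    using fvars_ren[OF ac] neq by (auto simp: image_iff)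
  ultimately show ?case unfolding ren_simps variant.simps by simp
qed (auto simp: ren_tm_comp dest: avoids_capture_Conn)

lemma variant_ren_target:
  assumes "variant d \<rho> A E" "y \<notin> set (bvars E)" "z \<notin> set (bvars E)"
  shows "variant d (\<lambda>v. ((\<lambda>v. v)(z := y)) (\<rho> v)) A (ren ((\<lambda>v. v)(z := y)) E)"
  using assms
proof (induction A arbitrary: \<rho> E)
  case (Conn c A B)
  from Conn.prems obtain E1 E2 where "E = Conn c E1 E2" "variant d \<rho> A E1" "variant d \<rho> B E2"
    by auto
  then show ?case using Conn.prems Conn.IH[of \<rho>] by simp
next
  case (Quant q x A)
  from Quant.prems show ?case
    unfolding variant.simps
  proof (induction E rule: copies.induct)
    case (single E)
    then obtain u D where E: "E = Quant q u D" and u: "u \<notin> \<rho> ` (fvars A - {x})"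
      and D: "variant d (\<rho>(x := u)) A D"
      by blast
    have neq: "u \<noteq> y" "u \<noteq> z" using single.prems E by auto
    have "variant d (\<lambda>v. ((\<lambda>v. v)(z := y)) ((\<rho>(x := u)) v)) A (ren ((\<lambda>v. v)(z := y)) D)"
      using single.prems E by (intro Quant.IH[OF D]) auto
    moreover have "(\<lambda>v. ((\<lambda>v. v)(z := y)) ((\<rho>(x := u)) v)) = (\<lambda>v. ((\<lambda>v. v)(z := y)) (\<rho> v))(x := u)"
      using neq by auto
    moreover have "((\<lambda>v. v)(z := y))(u := u) = (\<lambda>v. v)(z := y)" using neq by auto
    moreover have "u \<notin> (\<lambda>v. ((\<lambda>v. v)(z := y)) (\<rho> v)) ` (fvars A - {x})"
      using u neq by (auto split: if_splits)
    ultimately show ?case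
      unfolding E ren_simps by (intro copies.single) metis
  next
    case (dup E1 E2)
    then show ?case by (simp add: copies.dup)
  qed
qed (simp_all add: ren_tm_comp)

lemma fvars_alpha: "alpha_equiv A B \<Longrightarrow> fvars A = fvars B"
proof (induction rule: alpha_equiv.induct)
  case (rename y A q x)
  then have ac: "avoids_capture ((\<lambda>v. v)(x := y)) A" by (auto simp: avoids_capture_def)
  have "((\<lambda>v. v)(x := y)) ` fvars A - {y} = fvars A - {x}"
    using rename by (auto split: if_splits)
  then show ?case
    by (simp add: ren_id_upd fvars_ren[OF ac] del: fun_upd_apply)
qed auto

text \<open>The relation only looks at the binding structure of its source, and this is what \<open>\<alpha>\<close>-equivalence
  preserves. Stated as an equation of predicates, the closure of \<open>\<alpha>\<close>-equivalence under symmetry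
  and transitivity costs nothing.\<close>
lemma variant_alpha:
  "alpha_equiv A B \<Longrightarrow> variant d \<rho> A = variant d \<rho> B"
proof (induction arbitrary: \<rho> rule: alpha_equiv.induct)
  case (rename y A q x)
  have ac: "avoids_capture ((\<lambda>v. v)(x := y)) A"
    using rename by (auto simp: avoids_capture_def)
  have "variant d (\<rho>(y := u)) (ren ((\<lambda>v. v)(x := y)) A) = variant d (\<rho>(x := u)) A" for u
    unfolding variant_ren_source[OF ac] using rename by (intro variant_cong) auto
  moreover have "fvars (ren ((\<lambda>v. v)(x := y)) A) - {y} = fvars A - {x}"
    using rename fvars_alpha[OF alpha_equiv.rename[OF rename, of q x]] by (simp add: ren_id_upd)
  ultimately show ?case by (simp add: ren_id_upd)
next
  case (quant A A' q x)
  then show ?case unfolding variant.simps fvars_alpha[OF quant.hyps] by (simp only:)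
qed auto

lemma expand_step_fvars: "expand_step A B \<Longrightarrow> fvars B = fvars A"
  by (induction rule: expand_step.induct) auto

lemma variant_expand_step:
  "expand_step A B \<Longrightarrow> variant True \<rho> B E \<Longrightarrow> variant True \<rho> A E"
proof (induction arbitrary: \<rho> E rule: expand_step.induct)
  case (dup x B)
  then show ?case by (auto intro: copies.dup)
next
  case (quant A A' q x)
  show ?case
    using quant.prems unfolding variant.simps expand_step_fvars[OF quant.hyps]
    by (rule copies_mono[THEN predicate1D, rotated]) (use quant.IH in blast)
next
  case (connL A A' c B)
  then show ?case by (auto simp del: variant.simps(4))
next
  case (connR B B' c A)
  then show ?case by (auto simp del: variant.simps(4))
qed

lemma expand_steps_Conn:
  assumes "expand_step\<^sup>*\<^sup>* A A'" "expand_step\<^sup>*\<^sup>* B B'"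
  shows "expand_step\<^sup>*\<^sup>* (Conn c A B) (Conn c A' B')"
proof -
  have "expand_step\<^sup>*\<^sup>* (Conn c A B) (Conn c A' B)"
    using assms(1) by induction (auto intro: expand_step.intros rtranclp.rtrancl_into_rtrancl)
  also have "expand_step\<^sup>*\<^sup>* (Conn c A' B) (Conn c A' B')"
    using assms(2) by induction (auto intro: expand_step.intros rtranclp.rtrancl_into_rtrancl)
  finally show ?thesis .
qed

lemma expand_steps_Quant:
  "expand_step\<^sup>*\<^sup>* A A' \<Longrightarrow> expand_step\<^sup>*\<^sup>* (Quant q x A) (Quant q x A')"
  by (induction rule: rtranclp_induct) (auto intro: expand_step.intros rtranclp.rtrancl_into_rtrancl)

lemma expand_steps_fvars: "expand_step\<^sup>*\<^sup>* A B \<Longrightarrow> fvars B = fvars A"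
  by (induction rule: rtranclp_induct) (auto simp: expand_step_fvars)

text \<open>Duplications inside a copy do not interfere with the choice of names, so all of them can be
  performed before any renaming.\<close>
lemma variant_decompose:
  "variant True \<rho> A E \<Longrightarrow> \<exists>C. expand_step\<^sup>*\<^sup>* A C \<and> variant False \<rho> C E"
proof (induction A arbitrary: \<rho> E)
  case (Conn c A B)
  from Conn.prems obtain E1 E2 where E: "E = Conn c E1 E2" "variant True \<rho> A E1" "variant True \<rho> B E2"
    by auto
  obtain C1 C2 where "expand_step\<^sup>*\<^sup>* A C1" "variant False \<rho> C1 E1"
    "expand_step\<^sup>*\<^sup>* B C2" "variant False \<rho> C2 E2"
    using Conn.IH(1)[OF E(2)] Conn.IH(2)[OF E(3)] by blast
  then show ?case
    using expand_steps_Conn[of A C1 B C2 c] E(1) by (intro exI[of _ "Conn c C1 C2"]) simp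
next
  case (Quant q x A)
  from Quant.prems show ?case
    unfolding variant.simps
  proof (induction E rule: copies.induct)
    case (single E)
    then obtain y D where E: "E = Quant q y D" and y: "y \<notin> \<rho> ` (fvars A - {x})"
      and D: "variant True (\<rho>(x := y)) A D"
      by blast
    obtain C where C: "expand_step\<^sup>*\<^sup>* A C" "variant False (\<rho>(x := y)) C D"
      using Quant.IH[OF D] by blast
    have "variant False \<rho> (Quant q x C) E"
      using E y C expand_steps_fvars[OF C(1)] by (auto intro!: copies.single)
    then show ?case using expand_steps_Quant[OF C(1)] by blast
  next
    case (dup E1 E2)
    then obtain C1 C2 where C: "expand_step\<^sup>*\<^sup>* (Quant q x A) C1" "variant False \<rho> C1 E1"
      "expand_step\<^sup>*\<^sup>* (Quant q x A) C2" "variant False \<rho> C2 E2" and q: "q = Ex"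
      by blast
    have "expand_step (Quant q x A) (Conn Or (Quant q x A) (Quant q x A))"
      unfolding q by (rule expand_step.dup)
    then have "expand_step\<^sup>*\<^sup>* (Quant q x A) (Conn Or C1 C2)"
      using expand_steps_Conn[OF C(1) C(3)] by (rule converse_rtranclp_into_rtranclp)
    then show ?case using C by auto
  qed
qed auto

lemma variant_False_Quant:
  "variant False \<rho> (Quant q x A) E \<longleftrightarrow>
    (\<exists>y D. E = Quant q y D \<and> y \<notin> \<rho> ` (fvars A - {x}) \<and> variant False (\<rho>(x := y)) A D)"
  by (auto elim: copies.cases intro: copies.single)

lemma finite_fvars: "finite (fvars A)"
proof -
  have "finite (tvars t)" for t :: "'a tm" by (induction t) auto
  then show ?thesis by (induction A) auto
qed

lemma alpha_freshen:
  "finite S \<Longrightarrow> \<exists>B. alpha_equiv A B \<and> set (bvars B) \<inter> S = {}"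
proof (induction A)
  case (Conn c A B)
  then obtain A' B' where "alpha_equiv A A'" "set (bvars A') \<inter> S = {}"
    "alpha_equiv B B'" "set (bvars B') \<inter> S = {}"
    by blast
  then show ?case by (intro exI[of _ "Conn c A' B'"]) (auto intro: alpha_equiv.conn)
next
  case (Quant q x A)
  then obtain B where B: "alpha_equiv A B" "set (bvars B) \<inter> S = {}"
    by blast
  have "finite (fvars B)" by (rule finite_fvars)
  then obtain y where y: "y \<notin> fvars B \<union> set (bvars B) \<union> S"
    using Quant.prems by (metis List.finite_set ex_new_if_finite finite_UnI infinite_UNIV_nat)
  let ?B = "Quant q y (subst (Var(x := Var y)) B)"
  have "alpha_equiv (Quant q x A) ?B"
    using alpha_equiv.quant[OF B(1)] alpha_equiv.rename[of y B q x] y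
    by (blast intro: alpha_equiv.trans)
  then show ?case
    using y B(2) by (intro exI[of _ ?B]) (auto simp: ren_id_upd)
qed (auto intro: alpha_equiv.refl)

text \<open>Renaming the bound variables of \<open>C\<close> one after the other could produce clashes between old and new
  names in the intermediate formulae. The two disjointness hypotheses exclude them.\<close>
lemma variant_alpha_ren:
  assumes "variant False \<rho> C E" "\<rho> ` fvars C \<inter> set (bvars C) = {}" "set (bvars E) \<inter> set (bvars C) = {}"
  shows "alpha_equiv (ren \<rho> C) E"
  using assms
proof (induction C arbitrary: \<rho> E)
  case (Conn c A B)
  from Conn.prems(1) obtain E1 E2 where E: "E = Conn c E1 E2" "variant False \<rho> A E1" "variant False \<rho> B E2"
    by auto
  have "alpha_equiv (ren \<rho> A) E1" "alpha_equiv (ren \<rho> B) E2"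
    using Conn.prems E by (auto intro!: Conn.IH)
  then show ?case using E(1) by (simp add: alpha_equiv.conn)
next
  case (Quant q x C)
  from Quant.prems(1) obtain y D where E: "E = Quant q y D"
    and y: "y \<notin> \<rho> ` (fvars C - {x})" and D: "variant False (\<rho>(x := y)) C D"
    unfolding variant_False_Quant by blast
  let ?C = "ren (\<rho>(x := x)) C"
  have yx: "y \<noteq> x" "y \<notin> set (bvars C)" using Quant.prems(3) E by auto
  have ac: "avoids_capture (\<rho>(x := x)) C"
    using Quant.prems(2) by (auto simp: avoids_capture_def)
  have "ren ((\<lambda>v. v)(x := y)) ?C = ren (\<rho>(x := y)) C"
    unfolding ren_comp[OF ac] using Quant.prems(2) by (intro ren_cong) auto
  moreover have "y \<notin> fvars ?C \<union> set (bvars ?C)"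
    using y yx by (auto simp: fvars_ren[OF ac])
  ultimately have "alpha_equiv (Quant q x ?C) (Quant q y (ren (\<rho>(x := y)) C))"
    using alpha_equiv.rename[of y ?C q x] by (simp add: ren_id_upd)
  moreover have "alpha_equiv (ren (\<rho>(x := y)) C) D"
    using Quant.prems yx E by (intro Quant.IH D) (auto simp: image_iff)
  ultimately show ?case
    using E by (auto intro: alpha_equiv.trans alpha_equiv.quant)
qed (auto intro: alpha_equiv.refl)

text \<open>From right to left, the expansion is first renamed so that its bound variables avoid those of \<open>E\<close>;
  then the renaming to \<open>E\<close> meets no clash.\<close>
lemma strong_or_expansion_iff_variant:
  "strong_or_expansion A E \<longleftrightarrow> variant True (\<lambda>v. v) A E"
proof
  assume "strong_or_expansion A E"
  then obtain C where C: "expand_step\<^sup>*\<^sup>* A C" "alpha_equiv C E"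
    by (auto simp: strong_or_expansion_def)
  have "variant True (\<lambda>v. v) C E"
    unfolding variant_alpha[OF C(2)] by (rule variant_refl)
  with C(1) show "variant True (\<lambda>v. v) A E"
    by (induction rule: converse_rtranclp_induct) (auto intro: variant_expand_step)
next
  assume "variant True (\<lambda>v. v) A E"
  then obtain C where C: "expand_step\<^sup>*\<^sup>* A C" "variant False (\<lambda>v. v) C E"
    by (blast dest: variant_decompose)
  have "finite (fvars C \<union> set (bvars E))" by (simp add: finite_fvars)
  then obtain B where B: "alpha_equiv C B" "set (bvars B) \<inter> (fvars C \<union> set (bvars E)) = {}"
    by (meson alpha_freshen)
  have "variant False (\<lambda>v. v) B E"
    using C(2) unfolding variant_alpha[OF B(1)] .
  then have "alpha_equiv (ren (\<lambda>v. v) B) E"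
    using B fvars_alpha[OF B(1)] by (intro variant_alpha_ren) auto
  then have "alpha_equiv C E"
    unfolding ren_id by (rule alpha_equiv.trans[OF B(1)])
  then show "strong_or_expansion A E"
    using C(1) by (auto simp: strong_or_expansion_def)
qed

section \<open>Prefixes of prenexifications\<close>
text \<open>Pulling a quantifier outwards leaves literals and connectives in place, so all prenexifications of
  \<open>A\<close> have the matrix \<open>strip A\<close> and differ in their prefixes only.\<close>
primrec strip :: "('f, 'p) fm \<Rightarrow> ('f, 'p) fm" where
  "strip (Pos p ts) = Pos p ts"
| "strip (Neg p ts) = Neg p ts"
| "strip (Conn c A B) = Conn c (strip A) (strip B)"
| "strip (Quant q x A) = strip A"

text \<open>The prefixes of the prenexifications of \<open>A\<close>: the linear orders of its quantifiers that respect
  nesting.\<close>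
primrec orders :: "('f, 'p) fm \<Rightarrow> (quant \<times> nat) list set" where
  "orders (Pos p ts) = {[]}"
| "orders (Neg p ts) = {[]}"
| "orders (Conn c A B) = (\<Union>P\<in>orders A. \<Union>Q\<in>orders B. shuffles P Q)"
| "orders (Quant q x A) = (#) (q, x) ` orders A"

lemma quantifier_free_strip [simp]: "quantifier_free (strip A)"
  by (induction A) auto

lemma orders_mset: "Q \<in> orders A \<Longrightarrow> mset (map snd Q) = mset (bvars A)"
  by (induction A arbitrary: Q) (auto dest!: mset_shuffles)

lemma orders_set: "Q \<in> orders A \<Longrightarrow> snd ` set Q = set (bvars A)"
  using orders_mset[of Q A] by (metis set_map set_mset_mset)

lemma prenex_step_orders:
  "prenex_step A B \<Longrightarrow> orders B \<subseteq> orders A \<and> strip B = strip A"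
proof (induction rule: prenex_step.induct)
  case (pullL c q x A B)
  then show ?case by (force intro: Cons_in_shuffles_leftI)
next
  case (pullR c A q x B)
  then show ?case by (force intro: Cons_in_shuffles_rightI)
qed auto

lemma prenex_steps_orders:
  "prenex_step\<^sup>*\<^sup>* A B \<Longrightarrow> orders B \<subseteq> orders A \<and> strip B = strip A"
  by (induction rule: rtranclp_induct) (auto dest!: prenex_step_orders)

lemma prenex_orders: "prenex P \<Longrightarrow> orders P = {prefix P} \<and> strip P = matrix P"
proof -
  have "quantifier_free A \<Longrightarrow> orders A = {[]} \<and> strip A = A \<and> prefix A = []" for A :: "('f, 'p) fm"
    by (induction A) auto
  then show "prenex P \<Longrightarrow> orders P = {prefix P} \<and> strip P = matrix P" for P :: "('f, 'p) fm"
    by (induction P) (auto simp: prenex_def)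
qed

definition quantify :: "(quant \<times> nat) list \<Rightarrow> ('f, 'p) fm \<Rightarrow> ('f, 'p) fm" where
  "quantify Q M = foldr (\<lambda>(q, x). Quant q x) Q M"

lemma quantify_simps [simp]:
  "quantify [] M = M"
  "quantify ((q, x) # Q) M = Quant q x (quantify Q M)"
  by (simp_all add: quantify_def)

lemma prefix_quantify:
  "quantifier_free M \<Longrightarrow> prefix (quantify Q M) = Q \<and> matrix (quantify Q M) = M"
proof (induction Q)
  case Nil
  then show ?case by (cases M) auto
qed auto

lemma prenex_steps_Quant:
  "prenex_step\<^sup>*\<^sup>* A A' \<Longrightarrow> prenex_step\<^sup>*\<^sup>* (Quant q x A) (Quant q x A')"
  by (induction rule: rtranclp_induct) (auto intro: prenex_step.intros rtranclp.rtrancl_into_rtrancl)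

lemma prenex_steps_Conn:
  assumes "prenex_step\<^sup>*\<^sup>* A A'" "prenex_step\<^sup>*\<^sup>* B B'"
  shows "prenex_step\<^sup>*\<^sup>* (Conn c A B) (Conn c A' B')"
proof -
  have "prenex_step\<^sup>*\<^sup>* (Conn c A B) (Conn c A' B)"
    using assms(1) by induction (auto intro: prenex_step.intros rtranclp.rtrancl_into_rtrancl)
  also have "prenex_step\<^sup>*\<^sup>* (Conn c A' B) (Conn c A' B')"
    using assms(2) by induction (auto intro: prenex_step.intros rtranclp.rtrancl_into_rtrancl)
  finally show ?thesis .
qed

text \<open>A shuffle records which of the two prefixes the next outermost quantifier is pulled from.\<close>
lemma prenex_steps_shuffle:
  "R \<in> shuffles P Q \<Longrightarrow>
    prenex_step\<^sup>*\<^sup>* (Conn c (quantify P M) (quantify Q N)) (quantify R (Conn c M N))"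
proof (induction R arbitrary: P Q)
  case Nil
  then show ?case by simp
next
  case (Cons r R)
  obtain q x where r: "r = (q, x)" by fastforce
  from Cons.prems consider (left) P' where "P = r # P'" "R \<in> shuffles P' Q"
    | (right) Q' where "Q = r # Q'" "R \<in> shuffles P Q'"
    unfolding Cons_in_shuffles_iff by (metis list.collapse)
  then show ?case
  proof cases
    case left
    have "prenex_step (Conn c (quantify P M) (quantify Q N))
        (Quant q x (Conn c (quantify P' M) (quantify Q N)))"
      using left r by (auto intro: prenex_step.pullL)
    also have "prenex_step\<^sup>*\<^sup>* \<dots> (Quant q x (quantify R (Conn c M N)))"
      by (rule prenex_steps_Quant[OF Cons.IH[OF left(2)]])
    finally show ?thesis using r by simp
  next
    case right
    have "prenex_step (Conn c (quantify P M) (quantify Q N))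
        (Quant q x (Conn c (quantify P M) (quantify Q' N)))"
      using right r by (auto intro: prenex_step.pullR)
    also have "prenex_step\<^sup>*\<^sup>* \<dots> (Quant q x (quantify R (Conn c M N)))"
      by (rule prenex_steps_Quant[OF Cons.IH[OF right(2)]])
    finally show ?thesis using r by simp
  qed
qed

lemma prenex_steps_quantify:
  "Q \<in> orders A \<Longrightarrow> prenex_step\<^sup>*\<^sup>* A (quantify Q (strip A))"
proof (induction A arbitrary: Q)
  case (Conn c A B)
  then obtain P R where PR: "P \<in> orders A" "R \<in> orders B" "Q \<in> shuffles P R" by auto
  show ?case
    using prenex_steps_Conn[OF Conn.IH(1)[OF PR(1)] Conn.IH(2)[OF PR(2)]]
      prenex_steps_shuffle[OF PR(3)] unfolding strip.simps by (rule rtranclp_trans)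
next
  case (Quant q x A)
  then obtain Q' where "Q = (q, x) # Q'" "Q' \<in> orders A" by auto
  then show ?case using prenex_steps_Quant[OF Quant.IH] by simp
qed auto

section \<open>Herbrand proofs without prenex formulae\<close>
lemma set_quantified [simp]: "x \<in> set (quantified q Q) \<longleftrightarrow> (q, x) \<in> set Q"
  by (force simp: quantified_def)

text \<open>A witnessing substitution as a function on variables instead of a list of terms that is aligned
  with the prefix: when a quantifier is deleted, no positions have to be shifted.\<close>
definition witness_function ::
  "('f \<Rightarrow> nat) \<Rightarrow> (quant \<times> nat) list \<Rightarrow> (nat \<Rightarrow> 'f tm) \<Rightarrow> bool" where
  "witness_function fa Q w \<longleftrightarrow>
    (\<forall>x. (Ex, x) \<notin> set Q \<longrightarrow> w x = Var x) \<and>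
    (\<forall>Q1 y Q2. Q = Q1 @ (Ex, y) # Q2 \<longrightarrow>
      wf_tm fa (w y) \<and> (\<forall>x\<in>tvars (w y) \<inter> snd ` set Q. (All, x) \<in> set Q1))"

text \<open>The existence of a Herbrand proof of \<open>E\<close> without further expansion, in terms of the order \<open>Q\<close> and
  the witnesses \<open>w\<close> only; the prenex formula itself is not mentioned. See
  \<open>herbrand_via_prenexification\<close> and \<open>prenexification_herbrand_via\<close>.\<close>
definition herbrand_via ::
  "('f \<Rightarrow> nat) \<Rightarrow> (quant \<times> nat) list \<Rightarrow> (nat \<Rightarrow> 'f tm) \<Rightarrow> ('f, 'p) fm \<Rightarrow> bool" where
  "herbrand_via fa Q w E \<longleftrightarrow>
    alpha_normal E \<and> set (bvars E) \<inter> fvars E = {} \<and> Q \<in> orders E \<and>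
    witness_function fa Q w \<and> tautology (subst w (strip E))"

lemma herbrand_via_prenexification:
  assumes "herbrand_via fa Q w E"
  shows "\<exists>P ts. prenexification E P \<and> witnessing_substitution fa P ts"
proof (intro exI conjI)
  let ?P = "quantify Q (strip E)" and ?ts = "map w (quantified Ex Q)"
  note h = assms[unfolded herbrand_via_def witness_function_def]
  have pre: "prefix ?P = Q" "matrix ?P = strip E"
    by (simp_all add: prefix_quantify)
  then have prenex: "prenex ?P"
    by (simp add: prenex_def)
  show "prenexification E ?P"
    using h prenex prenex_steps_quantify[of Q E] by (auto simp: prenexification_def)
  have bv: "bvars ?P = map snd Q"
    using bvars_prenex[OF prenex] pre by simp
  have "mset (map snd Q) = mset (bvars E)"
    using h orders_mset by blast
  then have "alpha_normal ?P"
    using h mset_eq_imp_distinct_iff unfolding alpha_normal_def bv by blast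
  moreover have "wf_tm fa (w y)" if "(Ex, y) \<in> set Q" for y
    using h split_list[OF that] by blast
  then have "list_all (wf_tm fa) ?ts"
    by (simp add: list_all_iff)
  moreover have "tvars (?ts ! length (quantified Ex Q1)) \<inter> set (bvars ?P) \<subseteq> set (quantified All Q1)"
    if Q: "Q = Q1 @ (Ex, y) # Q2" for Q1 y Q2
  proof -
    have "quantified Ex Q = quantified Ex Q1 @ y # quantified Ex Q2"
      using Q by (simp add: quantified_def)
    then have "?ts ! length (quantified Ex Q1) = w y"
      by (simp add: nth_append)
    moreover have "\<forall>x\<in>tvars (w y) \<inter> snd ` set Q. (All, x) \<in> set Q1"
      using h Q by blast
    ultimately show ?thesis unfolding bv by force
  qed
  moreover have "witness_subst Q ?ts = w"
    using h by (auto simp: witness_subst_def map_of_zip_map)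
  ultimately show "witnessing_substitution fa ?P ?ts"
    using h prenex by (simp add: witnessing_substitution_def pre)
qed

lemma prenexification_herbrand_via:
  assumes "prenexification E P" "witnessing_substitution fa P ts"
  shows "\<exists>Q w. herbrand_via fa Q w E"
proof (intro exI)
  let ?Q = "prefix P" and ?w = "witness_subst (prefix P) ts"
  note pn = assms(1)[unfolded prenexification_def]
  note ws = assms(2)[unfolded witnessing_substitution_def]
  have Q: "?Q \<in> orders E" and M: "strip E = matrix P"
    using pn prenex_steps_orders[of E P] prenex_orders[of P] by auto
  have bv: "bvars P = map snd ?Q"
    using pn by (intro bvars_prenex) blast
  have "?w x = Var x" if "(Ex, x) \<notin> set ?Q" for x
  proof -
    have "map_of (zip (quantified Ex ?Q) ts) x = None"
      using that ws by (simp add: map_of_zip_is_None)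
    then show ?thesis by (simp add: witness_subst_def)
  qed
  moreover have "wf_tm fa (?w y) \<and> (\<forall>x\<in>tvars (?w y) \<inter> snd ` set ?Q. (All, x) \<in> set Q1)"
    if Q: "?Q = Q1 @ (Ex, y) # Q2" for Q1 y Q2
  proof -
    let ?ys = "quantified Ex ?Q" and ?n = "length (quantified Ex Q1)"
    have ys: "?ys = quantified Ex Q1 @ y # quantified Ex Q2"
      using Q by (simp add: quantified_def)
    have "distinct ?ys"
      using ws bv by (simp add: quantified_def distinct_map_filter alpha_normal_def)
    then have "map_of (zip ?ys ts) (?ys ! ?n) = Some (ts ! ?n)"
      using ws ys by (intro map_of_zip_nth) auto
    then have "?w y = ts ! ?n"
      by (simp add: witness_subst_def ys)
    moreover have "wf_tm fa (ts ! ?n)"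
      using ws ys by (simp add: list_all_length)
    moreover have "tvars (ts ! ?n) \<inter> set (bvars P) \<subseteq> set (quantified All Q1)"
      using ws Q by blast
    ultimately show ?thesis by (force simp: bv)
  qed
  ultimately have "witness_function fa ?Q ?w"
    unfolding witness_function_def by blast
  then show "herbrand_via fa ?Q ?w E"
    using pn ws Q M by (auto simp: herbrand_via_def)
qed

section \<open>Contexts\<close>
primrec compose_ctx :: "('f, 'p) fctx \<Rightarrow> ('f, 'p) fctx \<Rightarrow> ('f, 'p) fctx" where
  "compose_ctx Hole L = L"
| "compose_ctx (ConnL c K B) L = ConnL c (compose_ctx K L) B"
| "compose_ctx (ConnR c B K) L = ConnR c B (compose_ctx K L)"
| "compose_ctx (QuantC q x K) L = QuantC q x (compose_ctx K L)"

lemma fill_compose_ctx: "fill_fctx (compose_ctx K L) A = fill_fctx K (fill_fctx L A)"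
  by (induction K) auto

text \<open>Contracting inside one member of a sequent is thus contracting inside a formula.\<close>

lemma Disj_ctx: "\<exists>K. \<forall>E. Disj (\<Delta> @ E # \<Theta>) = fill_fctx K E"
proof (induction \<Delta>)
  case Nil
  show ?case
  proof (cases \<Theta>)
    case Nil
    then show ?thesis by (auto intro!: exI[of _ Hole])
  next
    case (Cons B \<Theta>')
    then show ?thesis by (auto intro!: exI[of _ "ConnL Or Hole (Disj \<Theta>)"])
  qed
next
  case (Cons B \<Delta>)
  then obtain K where K: "\<forall>E. Disj (\<Delta> @ E # \<Theta>) = fill_fctx K E" by blast
  have "Disj ((B # \<Delta>) @ E # \<Theta>) = fill_fctx (ConnR Or B K) E" for E
    using K[rule_format, of E] by (cases "\<Delta> @ E # \<Theta>") auto
  then show ?case by blast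
qed

section \<open>Rearrangements that preserve order and witnesses\<close>
text \<open>Sufficient for every Herbrand proof of \<open>K{A}\<close> to be one of \<open>K{B}\<close>, with the same order of the
  quantifiers and the same witnesses. Each condition is monotone in contexts; for the
  one on valuations, this is because the hole is in positive position.\<close>
definition refines :: "('f, 'p) fm \<Rightarrow> ('f, 'p) fm \<Rightarrow> bool" where
  "refines A B \<longleftrightarrow>
    mset (bvars B) = mset (bvars A) \<and> fvars B \<subseteq> fvars A \<and> orders A \<subseteq> orders B \<and>
    (\<forall>w v. prop_eval v (subst w (strip A)) \<longrightarrow> prop_eval v (subst w (strip B)))"

lemma refines_fill: "refines A B \<Longrightarrow> refines (fill_fctx K A) (fill_fctx K B)"
proof (induction K)
  case (ConnL c K C)
  then have "orders (fill_fctx (ConnL c K C) A) \<subseteq> orders (fill_fctx (ConnL c K C) B)"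
    unfolding refines_def fill_fctx.simps orders.simps by blast
  then show ?case using ConnL by (auto simp: refines_def split: conn.split)
next
  case (ConnR c C K)
  then have "orders (fill_fctx (ConnR c C K) A) \<subseteq> orders (fill_fctx (ConnR c C K) B)"
    unfolding refines_def fill_fctx.simps orders.simps by blast
  then show ?case using ConnR by (auto simp: refines_def split: conn.split)
qed (auto simp: refines_def)

lemma quantifier_free_subst [simp]: "quantifier_free (subst w A) \<longleftrightarrow> quantifier_free A"
  by (induction A arbitrary: w) auto

lemma herbrand_via_refines:
  assumes "refines A B" "herbrand_via fa Q w A"
  shows "herbrand_via fa Q w B"
proof -
  have "set (bvars B) = set (bvars A)" "distinct (bvars B) = distinct (bvars A)"
    using assms(1) unfolding refines_def by (metis mset_eq_setD, metis mset_eq_imp_distinct_iff)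
  then show ?thesis
    using assms by (auto simp: herbrand_via_def refines_def alpha_normal_def tautology_def)
qed

lemma refines_Or_commute: "refines (Conn Or A B) (Conn Or B A)"
proof -
  have "orders (Conn Or A B) \<subseteq> orders (Conn Or B A)"
    using shuffles_commutes by fastforce
  then show ?thesis by (auto simp: refines_def)
qed

text \<open>Colour each entry of \<open>R\<close> by the list \<open>A\<close>, \<open>B\<close>, \<open>C\<close> or \<open>D\<close> that it comes from. Grouping the four colours
  differently gives another pair of lists with the same shuffle.\<close>
lemma shuffles_interchange:
  assumes "R \<in> shuffles X Y" "X \<in> shuffles A B" "Y \<in> shuffles C D"
  shows "\<exists>X'\<in>shuffles A C. \<exists>Y'\<in>shuffles B D. R \<in> shuffles X' Y'"
  using assms
proof (induction R arbitrary: X Y A B C D)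
  case Nil
  then show ?case by auto
next
  case (Cons r R)
  have split: "\<exists>Z'. Z = r # Z' \<and> R \<in> shuffles Z' Z2 \<or> Z2 = r # Z' \<and> R \<in> shuffles Z Z'"
    if "r # R \<in> shuffles Z Z2" for r R and Z Z2 :: "'a list"
    using that unfolding Cons_in_shuffles_iff by (metis list.collapse)
  from split[OF Cons.prems(1)] consider
    (X) X1 where "X = r # X1" "R \<in> shuffles X1 Y" | (Y) Y1 where "Y = r # Y1" "R \<in> shuffles X Y1"
    by blast
  then show ?case
  proof cases
    case X
    from split[OF Cons.prems(2)[unfolded X(1)]] consider
      (A) A1 where "A = r # A1" "X1 \<in> shuffles A1 B" | (B) B1 where "B = r # B1" "X1 \<in> shuffles A B1"
      by blast
    then show ?thesis
    proof cases
      case A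
      from Cons.IH[OF X(2) A(2) Cons.prems(3)] show ?thesis
        unfolding A by (blast intro: Cons_in_shuffles_leftI)
    next
      case B
      from Cons.IH[OF X(2) B(2) Cons.prems(3)] show ?thesis
        unfolding B by (blast intro: Cons_in_shuffles_leftI Cons_in_shuffles_rightI)
    qed
  next
    case Y
    from split[OF Cons.prems(3)[unfolded Y(1)]] consider
      (C) C1 where "C = r # C1" "Y1 \<in> shuffles C1 D" | (D) D1 where "D = r # D1" "Y1 \<in> shuffles C D1"
      by blast
    then show ?thesis
    proof cases
      case C
      from Cons.IH[OF Y(2) Cons.prems(2) C(2)] show ?thesis
        unfolding C by (blast intro: Cons_in_shuffles_leftI Cons_in_shuffles_rightI)
    next
      case D
      from Cons.IH[OF Y(2) Cons.prems(2) D(2)] show ?thesis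
        unfolding D by (blast intro: Cons_in_shuffles_leftI Cons_in_shuffles_rightI)
    qed
  qed
qed

text \<open>For \<open>c = And\<close> the matrix becomes weaker by the medial inference; for \<open>c = Or\<close> the two matrices are
  equivalent. The rearrangement does not change which quantifier lies in the scope of which.\<close>
lemma refines_medial:
  "refines (Conn Or (Conn c A B) (Conn c A' B')) (Conn c (Conn Or A A') (Conn Or B B'))"
proof -
  have "orders (Conn Or (Conn c A B) (Conn c A' B')) \<subseteq> orders (Conn c (Conn Or A A') (Conn Or B B'))"
  proof
    fix R assume "R \<in> orders (Conn Or (Conn c A B) (Conn c A' B'))"
    then obtain P Q X P' Q' Y where "P \<in> orders A" "Q \<in> orders B" "X \<in> shuffles P Q"
      "P' \<in> orders A'" "Q' \<in> orders B'" "Y \<in> shuffles P' Q'" "R \<in> shuffles X Y"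
      by auto
    with shuffles_interchange[of R X Y P Q P' Q']
    show "R \<in> orders (Conn c (Conn Or A A') (Conn Or B B'))" by fastforce
  qed
  then show ?thesis
    by (auto simp: refines_def split: conn.splits)
qed

lemma refines_contract_literal:
  "orders A = {[]} \<Longrightarrow> bvars A = [] \<Longrightarrow> refines (Conn Or A A) A"
  by (auto simp: refines_def)

section \<open>Merging two universal quantifiers\<close>
lemma bvars_fill: "\<exists>M. \<forall>A. mset (bvars (fill_fctx K A)) = M + mset (bvars A)"
proof (induction K)
  case Hole
  show ?case by (auto intro: exI[of _ "{#}"])
next
  case (ConnL c K B)
  then obtain M where "\<forall>A. mset (bvars (fill_fctx K A)) = M + mset (bvars A)" by blast
  then show ?case by (auto intro!: exI[of _ "M + mset (bvars B)"])
next
  case (ConnR c B K)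
  then obtain M where "\<forall>A. mset (bvars (fill_fctx K A)) = M + mset (bvars A)" by blast
  then show ?case by (auto intro!: exI[of _ "M + mset (bvars B)"])
next
  case (QuantC q x K)
  then obtain M where "\<forall>A. mset (bvars (fill_fctx K A)) = M + mset (bvars A)" by blast
  then show ?case by (auto intro!: exI[of _ "add_mset x M"])
qed

lemma distinct_bvars_fill: "distinct (bvars (fill_fctx K A)) \<Longrightarrow> distinct (bvars A)"
  by (induction K) auto

lemma set_bvars_fill: "set (bvars A) \<subseteq> set (bvars (fill_fctx K A))"
  by (induction K) auto

lemma fvars_fill_mono: "fvars A \<subseteq> fvars B \<Longrightarrow> fvars (fill_fctx K A) \<subseteq> fvars (fill_fctx K B)"
  by (induction K) auto

lemma orders_ren [simp]: "orders (ren \<sigma> A) = orders A"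
  by (induction A arbitrary: \<sigma>) auto

lemma strip_ren: "(\<forall>x\<in>set (bvars A). \<sigma> x = x) \<Longrightarrow> strip (ren \<sigma> A) = ren \<sigma> (strip A)"
proof (induction A arbitrary: \<sigma>)
  case (Quant q x A)
  then have "\<sigma>(x := x) = \<sigma>" by auto
  then show ?case using Quant by simp
qed auto

lemma fvars_strip: "fvars (strip A) \<subseteq> fvars A \<union> set (bvars A)"
  by (induction A) auto

lemma ren_strip_idle:
  assumes "z \<notin> fvars A" "z \<notin> set (bvars A)"
  shows "ren ((\<lambda>v. v)(z := y)) (strip A) = strip A"
proof -
  have "ren ((\<lambda>v. v)(z := y)) (strip A) = ren (\<lambda>v. v) (strip A)"
    using assms fvars_strip[of A] by (intro ren_cong) auto
  then show ?thesis by simp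
qed

lemma filter_orders_none:
  assumes "Q \<in> orders A" "\<forall>x\<in>set (bvars A). \<not> P x"
  shows "filter (\<lambda>p. P (snd p)) Q = []"
  using assms orders_set[OF assms(1)] by (auto simp: filter_empty_conv)

lemma filter_orders_all:
  assumes "Q \<in> orders A" "\<forall>x\<in>set (bvars A). P x"
  shows "filter (\<lambda>p. P (snd p)) Q = Q"
  using assms orders_set[OF assms(1)] by (auto simp: filter_id_conv)

lemma filter_shuffle: "R \<in> shuffles P Q \<Longrightarrow> filter f R \<in> shuffles (filter f P) (filter f Q)"
  using filter_shuffles[of f P Q] by blast

text \<open>Filtering commutes with shuffling, so the two quantifiers can be followed through the whole formula.
  The two outcomes decide which of them can absorb the other.\<close>
lemma orders_of_two_universals:
  assumes "distinct (bvars (fill_fctx K (Conn Or (Quant All y A) (Quant All z B))))"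
    and "Q \<in> orders (fill_fctx K (Conn Or (Quant All y A) (Quant All z B)))"
  shows "filter (\<lambda>p. snd p \<in> {y, z}) Q \<in> {[(All, y), (All, z)], [(All, z), (All, y)]}"
  using assms
proof (induction K arbitrary: Q)
  case Hole
  then obtain P R where P: "P \<in> orders A" and R: "R \<in> orders B"
    and Q: "Q \<in> shuffles ((All, y) # P) ((All, z) # R)" by auto
  have "filter (\<lambda>p. snd p \<in> {y, z}) P = []" "filter (\<lambda>p. snd p \<in> {y, z}) R = []"
    using Hole.prems(1) by (intro filter_orders_none[OF P] filter_orders_none[OF R]; auto)+
  then show ?case
    using filter_shuffle[OF Q, of "\<lambda>p. snd p \<in> {y, z}"] by auto
next
  case (ConnL c K B')
  let ?f = "filter (\<lambda>p. snd p \<in> {y, z})" and ?X = "Conn Or (Quant All y A) (Quant All z B)"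
  from ConnL.prems obtain P R where P: "P \<in> orders (fill_fctx K ?X)" and R: "R \<in> orders B'"
    and Q: "Q \<in> shuffles P R" by auto
  have "?f R = []"
    using ConnL.prems(1) set_bvars_fill[of ?X K] by (intro filter_orders_none[OF R]) auto
  then have "?f Q = ?f P" using filter_shuffle[OF Q, of "\<lambda>p. snd p \<in> {y, z}"] by simp
  then show ?case using ConnL.IH[OF _ P] ConnL.prems(1) by simp
next
  case (ConnR c B' K)
  let ?f = "filter (\<lambda>p. snd p \<in> {y, z})" and ?X = "Conn Or (Quant All y A) (Quant All z B)"
  from ConnR.prems obtain P R where P: "P \<in> orders (fill_fctx K ?X)" and R: "R \<in> orders B'"
    and Q: "Q \<in> shuffles R P" by auto
  have "?f R = []"
    using ConnR.prems(1) set_bvars_fill[of ?X K] by (intro filter_orders_none[OF R]) auto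
  then have "?f Q = ?f P" using filter_shuffle[OF Q, of "\<lambda>p. snd p \<in> {y, z}"] by simp
  then show ?case using ConnR.IH[OF _ P] ConnR.prems(1) by simp
next
  case (QuantC q x K)
  let ?X = "Conn Or (Quant All y A) (Quant All z B)"
  from QuantC.prems obtain P where P: "P \<in> orders (fill_fctx K ?X)" "Q = (q, x) # P" by auto
  have "x \<noteq> y" "x \<noteq> z"
    using QuantC.prems(1) set_bvars_fill[of ?X K] by auto
  then show ?case
    using QuantC.IH[OF _ P(1)] QuantC.prems(1) by (simp add: P(2))
qed

text \<open>Merging puts \<open>B\<close> in the scope of \<open>y\<close>. This is compatible with the old order because there \<open>y\<close>
  precedes \<open>z\<close>, which in turn precedes all quantifiers of \<open>B\<close>.\<close>
lemma orders_merge_universals: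
  assumes "distinct (bvars (fill_fctx K (Conn Or (Quant All y A) (Quant All z B))))"
    and "Q \<in> orders (fill_fctx K (Conn Or (Quant All y A) (Quant All z B)))"
    and "filter (\<lambda>p. snd p \<in> {y, z}) Q = [(All, y), (All, z)]"
  shows "filter (\<lambda>p. snd p \<noteq> z) Q \<in> orders (fill_fctx K (Quant All y (Conn Or A (ren \<sigma> B))))"
  using assms
proof (induction K arbitrary: Q)
  case Hole
  then obtain P R where P: "P \<in> orders A" and R: "R \<in> orders B"
    and Q: "Q \<in> shuffles ((All, y) # P) ((All, z) # R)" by auto
  have yz: "y \<noteq> z" using Hole.prems(1) by auto
  obtain Q' where Q': "Q = (All, y) # Q'" "Q' \<in> shuffles P ((All, z) # R)"
    using Q Hole.prems(3) yz by auto
  have "filter (\<lambda>p. snd p \<noteq> z) P = P" "filter (\<lambda>p. snd p \<noteq> z) R = R"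
    using Hole.prems(1) by (intro filter_orders_all[OF P] filter_orders_all[OF R]; auto)+
  then have "filter (\<lambda>p. snd p \<noteq> z) Q' \<in> shuffles P R"
    using filter_shuffle[OF Q'(2), of "\<lambda>p. snd p \<noteq> z"] by simp
  then show ?case using P R Q' yz by auto
next
  case (ConnL c K B')
  let ?f = "filter (\<lambda>p. snd p \<in> {y, z})" and ?X = "Conn Or (Quant All y A) (Quant All z B)"
  from ConnL.prems obtain P R where P: "P \<in> orders (fill_fctx K ?X)" and R: "R \<in> orders B'"
    and Q: "Q \<in> shuffles P R" by auto
  have "?f R = []"
    using ConnL.prems(1) set_bvars_fill[of ?X K] by (intro filter_orders_none[OF R]) auto
  then have "?f P = [(All, y), (All, z)]"
    using filter_shuffle[OF Q, of "\<lambda>p. snd p \<in> {y, z}"] ConnL.prems(3) by simp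
  moreover have "filter (\<lambda>p. snd p \<noteq> z) R = R"
    using ConnL.prems(1) set_bvars_fill[of ?X K] by (intro filter_orders_all[OF R]) auto
  ultimately show ?case
    using ConnL.IH[OF _ P] ConnL.prems(1) R filter_shuffle[OF Q, of "\<lambda>p. snd p \<noteq> z"] by auto
next
  case (ConnR c B' K)
  let ?f = "filter (\<lambda>p. snd p \<in> {y, z})" and ?X = "Conn Or (Quant All y A) (Quant All z B)"
  from ConnR.prems obtain P R where P: "P \<in> orders (fill_fctx K ?X)" and R: "R \<in> orders B'"
    and Q: "Q \<in> shuffles R P" by auto
  have "?f R = []"
    using ConnR.prems(1) set_bvars_fill[of ?X K] by (intro filter_orders_none[OF R]) auto
  then have "?f P = [(All, y), (All, z)]"
    using filter_shuffle[OF Q, of "\<lambda>p. snd p \<in> {y, z}"] ConnR.prems(3) by simp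
  moreover have "filter (\<lambda>p. snd p \<noteq> z) R = R"
    using ConnR.prems(1) set_bvars_fill[of ?X K] by (intro filter_orders_all[OF R]) auto
  ultimately show ?case
    using ConnR.IH[OF _ P] ConnR.prems(1) R filter_shuffle[OF Q, of "\<lambda>p. snd p \<noteq> z"] by auto
next
  case (QuantC q x K)
  let ?X = "Conn Or (Quant All y A) (Quant All z B)"
  from QuantC.prems obtain P where P: "P \<in> orders (fill_fctx K ?X)" "Q = (q, x) # P" by auto
  have "x \<noteq> y" "x \<noteq> z"
    using QuantC.prems(1) set_bvars_fill[of ?X K] by auto
  then show ?case
    using QuantC.IH[OF _ P(1)] QuantC.prems(1,3) by (simp add: P(2))
qed

text \<open>The matrix may be renamed as a whole: \<open>z\<close> is bound just once and is not free, so that all its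
  occurrences lie in \<open>B\<close>.\<close>
lemma strip_merge_universals:
  assumes "distinct (bvars (fill_fctx K (Conn Or (Quant All y A) (Quant All z B))))"
    and "z \<notin> fvars (fill_fctx K (Conn Or (Quant All y A) (Quant All z B)))"
  shows "strip (fill_fctx K (Quant All y (Conn Or A (ren ((\<lambda>v. v)(z := y)) B)))) =
    ren ((\<lambda>v. v)(z := y)) (strip (fill_fctx K (Conn Or (Quant All y A) (Quant All z B))))"
  using assms
proof (induction K)
  case Hole
  then have "strip (ren ((\<lambda>v. v)(z := y)) B) = ren ((\<lambda>v. v)(z := y)) (strip B)"
    by (intro strip_ren) auto
  moreover have "ren ((\<lambda>v. v)(z := y)) (strip A) = strip A"
    using Hole by (intro ren_strip_idle) auto
  ultimately show ?case by (simp del: fun_upd_apply)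
next
  case (ConnL c K B')
  let ?X = "Conn Or (Quant All y A) (Quant All z B)"
  have "ren ((\<lambda>v. v)(z := y)) (strip B') = strip B'"
    using ConnL.prems set_bvars_fill[of ?X K] by (intro ren_strip_idle) auto
  then show ?case using ConnL by (simp del: fun_upd_apply)
next
  case (ConnR c B' K)
  let ?X = "Conn Or (Quant All y A) (Quant All z B)"
  have "ren ((\<lambda>v. v)(z := y)) (strip B') = strip B'"
    using ConnR.prems set_bvars_fill[of ?X K] by (intro ren_strip_idle) auto
  then show ?case using ConnR by (simp del: fun_upd_apply)
next
  case (QuantC q x K)
  let ?X = "Conn Or (Quant All y A) (Quant All z B)"
  show ?case using QuantC set_bvars_fill[of ?X K] by auto
qed

lemma filter_eq_appendD:
  "filter P Q = Q1 @ a # Q2 \<Longrightarrow> \<exists>R1 R2. Q = R1 @ a # R2 \<and> Q1 = filter P R1 \<and> P a"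
proof (induction Q arbitrary: Q1)
  case (Cons b Q)
  show ?case
  proof (cases "P b \<and> Q1 = []")
    case True
    then show ?thesis using Cons.prems by (intro exI[of _ "[]"] exI[of _ Q]) auto
  next
    case False
    then obtain Q1' where "filter P Q = Q1' @ a # Q2" "Q1 = filter P [b] @ Q1'"
      using Cons.prems by (cases Q1) (auto split: if_splits)
    with Cons.IH[OF this(1)] obtain R1 R2 where "Q = R1 @ a # R2" "Q1 = filter P (b # R1)" "P a"
      by auto
    then show ?thesis by (metis append_Cons)
  qed
qed simp

text \<open>A witness that mentions \<open>z\<close> belongs to a quantifier after \<open>z\<close>, hence after \<open>y\<close>, so it may mention \<open>y\<close>
  instead. If \<open>z\<close> came first, replacing it by \<open>y\<close> could violate the scope condition.\<close>
lemma witness_function_merge: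
  assumes w: "witness_function fa Q w"
    and order: "filter (\<lambda>p. snd p \<in> {y, z}) Q = [(All, y), (All, z)]"
    and yz: "y \<noteq> z"
  shows "witness_function fa (filter (\<lambda>p. snd p \<noteq> z) Q)
    (\<lambda>v. if v = z then Var z else ren_tm ((\<lambda>v. v)(z := y)) (w v))"
  unfolding witness_function_def
proof (intro conjI allI impI)
  fix x
  assume "(Ex, x) \<notin> set (filter (\<lambda>p. snd p \<noteq> z) Q)"
  then show "(if x = z then Var z else ren_tm ((\<lambda>v. v)(z := y)) (w x)) = Var x"
    using w by (auto simp: witness_function_def ren_tm_def)
next
  fix Q1 v Q2
  assume "filter (\<lambda>p. snd p \<noteq> z) Q = Q1 @ (Ex, v) # Q2"
  then obtain R1 R2 where Q: "Q = R1 @ (Ex, v) # R2" and Q1: "Q1 = filter (\<lambda>p. snd p \<noteq> z) R1"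
    and v: "v \<noteq> z"
    by (force dest: filter_eq_appendD)
  have wv: "wf_tm fa (w v)" "\<forall>x\<in>tvars (w v) \<inter> snd ` set Q. (All, x) \<in> set R1"
    using w Q unfolding witness_function_def by blast+
  have yQ: "(All, y) \<in> set Q1" if "(All, z) \<in> set R1"
  proof -
    obtain l m where l: "l = filter (\<lambda>p. snd p \<in> {y, z}) R1" and app: "l @ m = [(All, y), (All, z)]"
      using order Q by auto
    have "(All, z) \<in> set l" using that l by simp
    then have "(All, y) \<in> set l"
      using app yz by (cases l) auto
    then show ?thesis using Q1 l yz by simp
  qed
  show "wf_tm fa (if v = z then Var z else ren_tm ((\<lambda>v. v)(z := y)) (w v))"
    using wv(1) v by simp
  have zQ: "z \<in> snd ` set Q"
    using arg_cong[OF order, of set] by force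
  show "\<forall>x\<in>tvars (if v = z then Var z else ren_tm ((\<lambda>v. v)(z := y)) (w v)) \<inter>
      snd ` set (filter (\<lambda>p. snd p \<noteq> z) Q). (All, x) \<in> set Q1"
  proof
    fix x
    assume x: "x \<in> tvars (if v = z then Var z else ren_tm ((\<lambda>v. v)(z := y)) (w v)) \<inter>
      snd ` set (filter (\<lambda>p. snd p \<noteq> z) Q)"
    then obtain u where u: "u \<in> tvars (w v)" "x = ((\<lambda>v. v)(z := y)) u" using v by auto
    have xQ: "x \<noteq> z" "x \<in> snd ` set Q" using x by auto
    show "(All, x) \<in> set Q1"
    proof (cases "u = z")
      case True
      then show ?thesis using u wv(2) zQ yQ by auto
    next
      case False
      then show ?thesis using u wv(2) xQ Q1 by auto
    qed
  qed
qed

lemma subst_tm_ren_tm: "subst_tm w (ren_tm \<sigma> t) = subst_tm (\<lambda>v. w (\<sigma> v)) t"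
  by (induction t) (auto simp: ren_tm_def)

lemma ren_tm_subst_tm: "ren_tm \<sigma> (subst_tm w t) = subst_tm (\<lambda>v. ren_tm \<sigma> (w v)) t"
  by (induction t) (auto simp: ren_tm_def)

lemma subst_ren_qf: "quantifier_free M \<Longrightarrow> subst w (ren \<sigma> M) = subst (\<lambda>v. w (\<sigma> v)) M"
  by (induction M) (auto simp: subst_tm_ren_tm)

lemma ren_subst_qf:
  "quantifier_free M \<Longrightarrow> ren \<sigma> (subst w M) = subst (\<lambda>v. ren_tm \<sigma> (w v)) M"
  by (induction M) (auto simp: ren_tm_subst_tm)

lemma tautology_ren: "tautology M \<Longrightarrow> tautology (ren \<sigma> M)"
proof -
  have "prop_eval v (ren \<sigma> M) = prop_eval (\<lambda>p ts. v p (map (ren_tm \<sigma>) ts)) M"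
    if "quantifier_free M" for v and M :: "('a, 'b) fm"
    using that by (induction M) (auto split: conn.split)
  moreover have "quantifier_free (ren \<sigma> M) = quantifier_free M" for M :: "('a, 'b) fm"
    by (simp add: ren_def)
  ultimately show "tautology M \<Longrightarrow> tautology (ren \<sigma> M)" for M :: "('a, 'b) fm"
    by (simp add: tautology_def)
qed

text \<open>Identifying the universal variables \<open>y\<close> and \<open>z\<close> substitutes \<open>y\<close> for \<open>z\<close> in the propositional tautology,
  and tautologies are closed under substitution. The later of the two quantifiers has to be
  the one that disappears, because of the witnesses between them.\<close>
lemma herbrand_via_merge_earlier:
  fixes K :: "('f, 'p) fctx"
  assumes h: "herbrand_via fa Q w (fill_fctx K (Conn Or (Quant All y A) (Quant All z B)))"
    and order: "filter (\<lambda>p. snd p \<in> {y, z}) Q = [(All, y), (All, z)]"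
  shows "herbrand_via fa (filter (\<lambda>p. snd p \<noteq> z) Q)
    (\<lambda>v. if v = z then Var z else ren_tm ((\<lambda>v. v)(z := y)) (w v))
    (fill_fctx K (Quant All y (Conn Or A (ren ((\<lambda>v. v)(z := y)) B))))"
proof -
  let ?X = "Conn Or (Quant All y A) (Quant All z B)"
  let ?Y = "Quant All y (Conn Or A (ren ((\<lambda>v. v)(z := y)) B))"
  let ?E = "fill_fctx K ?X" and ?F = "fill_fctx K ?Y"
  let ?\<sigma> = "(\<lambda>v. v)(z := y)"
  let ?w = "\<lambda>v. if v = z then Var z else ren_tm ?\<sigma> (w v)"
  have dist: "distinct (bvars ?E)" and sep: "set (bvars ?E) \<inter> fvars ?E = {}"
    and Q: "Q \<in> orders ?E" and w: "witness_function fa Q w" and taut: "tautology (subst w (strip ?E))"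
    using h by (auto simp: herbrand_via_def alpha_normal_def)
  have distX: "distinct (bvars ?X)" using dist by (rule distinct_bvars_fill)
  then have yz: "y \<noteq> z" by auto
  have zE: "z \<notin> fvars ?E" using sep set_bvars_fill[of ?X K] by auto
  obtain M where M: "\<forall>A. mset (bvars (fill_fctx K A)) = M + mset (bvars A)"
    using bvars_fill by blast
  \<comment> \<open>Merging removes precisely the one occurrence of \<open>z\<close>.\<close>
  have "mset (bvars ?E) = mset (z # bvars ?F)" using M by simp
  then have bv: "set (bvars ?F) \<subseteq> set (bvars ?E)" "distinct (bvars ?F)"
    using dist by (metis mset_eq_setD set_subset_Cons, metis mset_eq_imp_distinct_iff distinct.simps(2))
  have "fvars ?Y \<subseteq> fvars ?X"
    using fvars_ren_subset[of ?\<sigma> B] by (auto split: if_splits)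
  then have fv: "fvars ?F \<subseteq> fvars ?E" by (rule fvars_fill_mono)
  have univ: "(All, y) \<in> set Q" "(All, z) \<in> set Q" "(Ex, y) \<notin> set Q" "(Ex, z) \<notin> set Q"
    using arg_cong[OF order, of set] by force+
  then have "w y = Var y" "w z = Var z" using w by (auto simp: witness_function_def)
  \<comment> \<open>At \<open>z\<close>, both sides are \<open>Var y\<close>, because \<open>w\<close> leaves universal variables alone.\<close>
  then have "(\<lambda>v. ?w (?\<sigma> v)) = (\<lambda>v. ren_tm ?\<sigma> (w v))"
    using yz by (auto simp: ren_tm_def)
  then have "subst ?w (strip ?F) = ren ?\<sigma> (subst w (strip ?E))"
    unfolding strip_merge_universals[OF dist zE]
    by (simp only: subst_ren_qf ren_subst_qf quantifier_free_strip)
  then have "tautology (subst ?w (strip ?F))"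
    using tautology_ren[OF taut] by (simp only:)
  then show ?thesis
    using orders_merge_universals[OF dist Q order] witness_function_merge[OF w order yz] bv fv sep
    unfolding herbrand_via_def alpha_normal_def by blast
qed

text \<open>Which of the two quantifiers comes later is decided by the prefix of the given proof, not by the
  formula; hence the alternative.\<close>
lemma herbrand_via_merge_universals:
  assumes h: "herbrand_via fa Q w (fill_fctx K (Conn Or (Quant All y A) (Quant All z B)))"
  shows "\<exists>Q w. herbrand_via fa Q w (fill_fctx K (Quant All y (Conn Or A (ren ((\<lambda>v. v)(z := y)) B)))) \<or>
    herbrand_via fa Q w (fill_fctx K (Quant All z (Conn Or B (ren ((\<lambda>v. v)(y := z)) A))))"
proof -
  have "filter (\<lambda>p. snd p \<in> {y, z}) Q \<in> {[(All, y), (All, z)], [(All, z), (All, y)]}"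
    using h by (intro orders_of_two_universals) (auto simp: herbrand_via_def alpha_normal_def)
  moreover have "herbrand_via fa Q w (fill_fctx K (Conn Or (Quant All z B) (Quant All y A)))"
    using herbrand_via_refines[OF refines_fill[OF refines_Or_commute] h] .
  ultimately show ?thesis
    using herbrand_via_merge_earlier[OF h] herbrand_via_merge_earlier[of fa Q w K z B y A]
    by (auto simp: insert_commute)
qed

section \<open>Contraction\<close>
text \<open>The core of the argument: two expansions of \<open>A\<close> that stand in a disjunction can be replaced by a
  single expansion of \<open>A\<close>. The context \<open>K\<close> is arbitrary because the induction descends into the
  merged formula and moves what it leaves behind into the context. At an existential
  quantifier the descent stops, since the disjunction itself is an expansion there.\<close>
lemma merge_variants:
  assumes "herbrand_via fa Q w (fill_fctx K (Conn Or E1 E2))"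
    and "variant True \<rho> A E1" "variant True \<rho> A E2"
  shows "\<exists>E Q w. variant True \<rho> A E \<and> herbrand_via fa Q w (fill_fctx K E)"
  using assms
proof (induction A arbitrary: \<rho> K E1 E2 Q w)
  case (Pos p ts)
  have "refines (Conn Or E1 E2) E1"
    using Pos.prems(2,3) refines_contract_literal[of E1] by simp
  then show ?case
    using herbrand_via_refines[OF refines_fill Pos.prems(1)] Pos.prems(2) by blast
next
  case (Neg p ts)
  have "refines (Conn Or E1 E2) E1"
    using Neg.prems(2,3) refines_contract_literal[of E1] by simp
  then show ?case
    using herbrand_via_refines[OF refines_fill Neg.prems(1)] Neg.prems(2) by blast
next
  case (Conn c A B)
  then obtain A1 B1 A2 B2 where E: "E1 = Conn c A1 B1" "E2 = Conn c A2 B2"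
    and v: "variant True \<rho> A A1" "variant True \<rho> B B1" "variant True \<rho> A A2" "variant True \<rho> B B2"
    by auto
  have "herbrand_via fa Q w (fill_fctx K (Conn c (Conn Or A1 A2) (Conn Or B1 B2)))"
    using herbrand_via_refines[OF refines_fill[OF refines_medial] Conn.prems(1)[unfolded E]] .
  then have "herbrand_via fa Q w
      (fill_fctx (compose_ctx K (ConnL c Hole (Conn Or B1 B2))) (Conn Or A1 A2))"
    by (simp add: fill_compose_ctx)
  from Conn.IH(1)[OF this v(1) v(3)] obtain A' Q' w' where A': "variant True \<rho> A A'"
    and "herbrand_via fa Q' w' (fill_fctx (compose_ctx K (ConnR c A' Hole)) (Conn Or B1 B2))"
    by (auto simp: fill_compose_ctx)
  from Conn.IH(2)[OF this(2) v(2) v(4)] obtain B' Q'' w'' where "variant True \<rho> B B'"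
    "herbrand_via fa Q'' w'' (fill_fctx K (Conn c A' B'))"
    by (auto simp: fill_compose_ctx)
  with A' show ?case by auto
next
  case (Quant q x A)
  show ?case
  proof (cases q)
    case Ex
    then have "variant True \<rho> (Quant q x A) (Conn Or E1 E2)"
      using Quant.prems by (auto intro: copies.dup)
    then show ?thesis using Quant.prems(1) by blast
  next
    case All
    have "\<exists>y D. E = Quant All y D \<and> y \<notin> \<rho> ` (fvars A - {x}) \<and> variant True (\<rho>(x := y)) A D"
      if "variant True \<rho> (Quant q x A) E" for E
      using that All by (auto elim: copies.cases)
    from this[OF Quant.prems(2)] this[OF Quant.prems(3)]
    obtain y D1 z D2 where E: "E1 = Quant All y D1" "E2 = Quant All z D2"
      and y: "y \<notin> \<rho> ` (fvars A - {x})" and D1: "variant True (\<rho>(x := y)) A D1"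
      and z: "z \<notin> \<rho> ` (fvars A - {x})" and D2: "variant True (\<rho>(x := z)) A D2"
      by (elim exE conjE)
    have "distinct (bvars (fill_fctx K (Conn Or E1 E2)))"
      using Quant.prems(1) by (simp add: herbrand_via_def alpha_normal_def)
    from distinct_bvars_fill[OF this] have dist: "distinct (y # bvars D1 @ z # bvars D2)"
      by (simp add: E)
    \<comment> \<open>Stated for arbitrary names, so that it serves both outcomes of merging.\<close>
    have result: ?thesis
      if h: "herbrand_via fa Q w (fill_fctx K (Quant All y (Conn Or D1 (ren ((\<lambda>v. v)(z := y)) D2))))"
        and y: "y \<notin> \<rho> ` (fvars A - {x})" and D1: "variant True (\<rho>(x := y)) A D1"
        and z: "z \<notin> \<rho> ` (fvars A - {x})" and D2: "variant True (\<rho>(x := z)) A D2"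
        and fresh: "y \<notin> set (bvars D2)" "z \<notin> set (bvars D2)"
      for y z D1 D2 Q w
    proof -
      let ?D2 = "ren ((\<lambda>v. v)(z := y)) D2"
      have "variant True (\<lambda>v. ((\<lambda>v. v)(z := y)) ((\<rho>(x := z)) v)) A ?D2"
        using D2 fresh by (rule variant_ren_target)
      moreover have "variant True (\<lambda>v. ((\<lambda>v. v)(z := y)) ((\<rho>(x := z)) v)) A = variant True (\<rho>(x := y)) A"
        using z by (intro variant_cong) auto
      ultimately have D2': "variant True (\<rho>(x := y)) A ?D2" by simp
      have "herbrand_via fa Q w (fill_fctx (compose_ctx K (QuantC All y Hole)) (Conn Or D1 ?D2))"
        using h by (simp add: fill_compose_ctx)
      from Quant.IH[OF this D1 D2'] obtain D Q' w' where "variant True (\<rho>(x := y)) A D"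
        "herbrand_via fa Q' w' (fill_fctx K (Quant All y D))"
        by (auto simp: fill_compose_ctx simp del: fun_upd_apply)
      moreover from this(1) have "variant True \<rho> (Quant q x A) (Quant All y D)"
        using y All by (auto intro!: copies.single)
      ultimately show ?thesis by blast
    qed
    from herbrand_via_merge_universals[OF Quant.prems(1)[unfolded E]] show ?thesis
      using result[OF _ y D1 z D2] result[OF _ z D2 y D1] dist by auto
  qed
qed

lemma fvars_fill_contract [simp]: "fvars (fill_fctx K (Conn c A A)) = fvars (fill_fctx K A)"
  by (induction K) auto

text \<open>An expansion of \<open>K{A \<or> A}\<close> contains several expanded copies of \<open>A \<or> A\<close> if existential
  quantifiers above the hole have been duplicated. The copies are merged one after the other; the
  outer context \<open>L\<close> holds the rest of the expansion, including the copies already treated.\<close>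
lemma contract_in_variant:
  assumes "variant True \<rho> (fill_fctx K (Conn Or A A)) E" "herbrand_via fa Q w (fill_fctx L E)"
  shows "\<exists>E' Q' w'. variant True \<rho> (fill_fctx K A) E' \<and> herbrand_via fa Q' w' (fill_fctx L E')"
  using assms
proof (induction K arbitrary: \<rho> E L Q w)
  case Hole
  then show ?case using merge_variants by fastforce
next
  case (ConnL c K B)
  then obtain E1 E2 where E: "E = Conn c E1 E2" "variant True \<rho> (fill_fctx K (Conn Or A A)) E1"
    "variant True \<rho> B E2" by auto
  have "herbrand_via fa Q w (fill_fctx (compose_ctx L (ConnL c Hole E2)) E1)"
    using ConnL.prems(2) E(1) by (simp add: fill_compose_ctx)
  from ConnL.IH[OF E(2) this] E(3) show ?case
    by (fastforce simp: fill_compose_ctx)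
next
  case (ConnR c B K)
  then obtain E1 E2 where E: "E = Conn c E1 E2" "variant True \<rho> (fill_fctx K (Conn Or A A)) E2"
    "variant True \<rho> B E1" by auto
  have "herbrand_via fa Q w (fill_fctx (compose_ctx L (ConnR c E1 Hole)) E2)"
    using ConnR.prems(2) E(1) by (simp add: fill_compose_ctx)
  from ConnR.IH[OF E(2) this] E(3) show ?case
    by (fastforce simp: fill_compose_ctx)
next
  case (QuantC q x K)
  from QuantC.prems show ?case
    unfolding fill_fctx.simps variant.simps
  proof (induction E arbitrary: L Q w rule: copies.induct)
    case (single E)
    then obtain y D where E: "E = Quant q y D" and y: "y \<notin> \<rho> ` (fvars (fill_fctx K A) - {x})"
      and D: "variant True (\<rho>(x := y)) (fill_fctx K (Conn Or A A)) D"
      by auto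
    have "herbrand_via fa Q w (fill_fctx (compose_ctx L (QuantC q y Hole)) D)"
      using single.prems E by (simp add: fill_compose_ctx)
    from QuantC.IH[OF D this] obtain D' Q' w' where
      D': "variant True (\<rho>(x := y)) (fill_fctx K A) D'"
      and h: "herbrand_via fa Q' w' (fill_fctx L (Quant q y D'))"
      by (auto simp: fill_compose_ctx simp del: fun_upd_apply)
    have "variant True \<rho> (Quant q x (fill_fctx K A)) (Quant q y D')"
      unfolding variant.simps using y D' by (intro copies.single) blast
    then show ?case using h unfolding variant.simps by blast
  next
    case (dup E1 E2)
    have "herbrand_via fa Q w (fill_fctx (compose_ctx L (ConnL Or Hole E2)) E1)"
      using dup.prems by (simp add: fill_compose_ctx)
    from dup.IH(1)[OF this] obtain E1' Q' w' where E1':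
      "variant True \<rho> (Quant q x (fill_fctx K A)) E1'"
      "herbrand_via fa Q' w' (fill_fctx (compose_ctx L (ConnR Or E1' Hole)) E2)"
      unfolding variant.simps by (auto simp: fill_compose_ctx simp del: fun_upd_apply)
    from dup.IH(2)[OF E1'(2)] obtain E2' Q'' w'' where E2':
      "variant True \<rho> (Quant q x (fill_fctx K A)) E2'"
      "herbrand_via fa Q'' w'' (fill_fctx L (Conn Or E1' E2'))"
      unfolding variant.simps by (auto simp: fill_compose_ctx simp del: fun_upd_apply)
    show ?case
      using copies.dup[OF dup.hyps(1) E1'(1)[unfolded variant.simps] E2'(1)[unfolded variant.simps]] E2'(2)
      by blast
  qed
qed

theorem lemma13:
  fixes fa :: "'f \<Rightarrow> nat" and pa :: "'p \<Rightarrow> nat"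
    and \<Gamma> :: "('f, 'p) sctx" and A :: "('f, 'p) fm"
  assumes "\<exists>c. fa c = 0"
    and "wf_sctx fa pa \<Gamma>"
    and "wf_fm fa pa A"
    and "has_herbrand_proof fa (fill \<Gamma> (Conn Or A A))"
  shows "has_herbrand_proof fa (fill \<Gamma> A)"
proof -
  obtain \<Delta> K \<Theta> where \<Gamma>: "\<Gamma> = SeqCtx \<Delta> K \<Theta>" by (cases \<Gamma>)
  from assms(4) obtain \<Gamma>' P ts where
    exp: "list_all2 strong_or_expansion (\<Delta> @ fill_fctx K (Conn Or A A) # \<Theta>) \<Gamma>'"
    and herbrand: "prenexification (Disj \<Gamma>') P" "witnessing_substitution fa P ts"
    by (auto simp: has_herbrand_proof_def herbrand_proof_def strong_or_expansion_seq_def \<Gamma>)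
  from exp obtain \<Delta>' E \<Theta>' where \<Gamma>': "\<Gamma>' = \<Delta>' @ E # \<Theta>'"
    and side: "list_all2 strong_or_expansion \<Delta> \<Delta>'" "list_all2 strong_or_expansion \<Theta> \<Theta>'"
    and E: "strong_or_expansion (fill_fctx K (Conn Or A A)) E"
    by (auto simp: list_all2_append1 list_all2_Cons1)
  obtain L where L: "\<forall>E. Disj (\<Delta>' @ E # \<Theta>') = fill_fctx L E"
    using Disj_ctx by blast
  obtain Q w where "herbrand_via fa Q w (fill_fctx L E)"
    using prenexification_herbrand_via[OF herbrand] \<Gamma>' L by auto
  with E obtain E' Q' w' where E': "strong_or_expansion (fill_fctx K A) E'"
    and "herbrand_via fa Q' w' (Disj (\<Delta>' @ E' # \<Theta>'))"
    using contract_in_variant unfolding strong_or_expansion_iff_variant L[rule_format] by blast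
  from herbrand_via_prenexification[OF this(2)] obtain P' ts' where
    "prenexification (Disj (\<Delta>' @ E' # \<Theta>')) P'" "witnessing_substitution fa P' ts'"
    by blast
  moreover have "list_all2 strong_or_expansion (\<Delta> @ fill_fctx K A # \<Theta>) (\<Delta>' @ E' # \<Theta>')"
    using side E' by (auto intro: list_all2_appendI)
  ultimately have "herbrand_proof fa (fill \<Gamma> A) (\<Delta>' @ E' # \<Theta>', P', ts')"
    by (simp add: herbrand_proof_def strong_or_expansion_seq_def \<Gamma>)
  then show ?thesis
    unfolding has_herbrand_proof_def by blast
qed

end
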